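(* Let $n>d\ge1$ be integers, $\omega>0$, $\bm{A}\in\mathbb{R}^{d\times(n-d)}$ with $\inf_{\bm{j}\in\mathbb{Z}^{n-d}\setminus\{\bm{0}\}}|\bm{j}|^\omega\prod_{u=1}^d\|\bm{j}\cdot\mathrm{row}_u(\bm{A})\|>0$, $\bm{\alpha}_0\in\mathbb{R}^{1\times(n-d)}$ and $\widetilde{\bm{A}}=\binom{\bm{\alpha}_0}{\bm{A}}$. For $q\in\mathbb{N}$ and $\delta>0$ let $$\mathcal{A}(q,\delta)=\#\{\bm{a}\in\mathbb{Z}^d:\bm{a}/q\in(0,1]^d,\ \|(q,\bm{a})\cdot\widetilde{\bm{A}}\|<\delta\}.$$ Then for every $\varepsilon>0$ there is a constant $C_\varepsilon$ depending only on $\varepsilon$ and $\bm{A}$ such that for all $q\in\mathbb{N}$ and $\delta\in(0,1/2]$, $$\big|\mathcal{A}(q,\delta)-(2\delta)^{n-d}q^d\big|\le\varepsilon\delta^{n-d}q^d+C_\varepsilon\delta^{n-d-\omega}\Big(\log\frac1\delta\Big)^d.$$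
   Context: Vectors are row vectors; $\mathrm{row}_u(\bm{A})$ is the $u$-th row of $\bm{A}$; $\|y\|$ is the distance from $y\in\mathbb{R}$ to the nearest integer and for vectors $\|\bm{y}\|=\max_k\|y_k\|$; $|\bm{j}|$ is the supremum norm. *)

theory Defs
  imports "HOL-Analysis.Analysis"
begin

text \<open>
  The dimensions \<open>d\<close> and \<open>n - d\<close> are rendered as \<open>CARD('d)\<close> and \<open>CARD('m)\<close>. The \<open>d + 1\<close> coordinates of
  \<open>(q, a)\<close> are indexed by \<open>'d option\<close>, with \<open>None\<close> for the extra first coordinate.
\<close>

definition int_dist :: "real \<Rightarrow> real" where
  "int_dist y = \<bar>y - of_int (round y)\<bar>"

definition vec_int_dist :: "real ^ 'm \<Rightarrow> real" where
  "vec_int_dist y = (MAX k. int_dist (y $ k))"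

definition of_int_vec :: "int ^ 'm \<Rightarrow> real ^ 'm" where
  "of_int_vec j = (\<chi> k. of_int (j $ k))"

definition vec_cons :: "'a \<Rightarrow> 'a ^ 'd \<Rightarrow> 'a ^ ('d :: finite) option" where
  "vec_cons x v = (\<chi> i. case i of None \<Rightarrow> x | Some u \<Rightarrow> v $ u)"

text \<open>The argument \<open>B\<close> is the \<open>(d + 1) \<times> (n - d)\<close> matrix obtained by putting a row on top of \<open>A\<close>.\<close>

definition count_A :: "real ^ 'm ^ ('d :: finite) option \<Rightarrow> nat \<Rightarrow> real \<Rightarrow> nat" where
  "count_A B q \<delta> =
     card {a :: int ^ 'd. (\<forall>u. real_of_int (a $ u) / real q \<in> {0<..1}) \<and>
             vec_int_dist (vec_cons (real q) (of_int_vec a) v* B) < \<delta>}"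

end

theory Submission
  imports Defs
begin

text \<open>
  The indicator of the box \<open>\<parallel>x\<^sub>k\<parallel> < \<delta>\<close> is compared with products of one-variable
  trigonometric polynomials of degree \<open>O(1/\<delta>)\<close>, whose Fourier coefficients are \<open>O(\<delta>)\<close>. Summing such a
  product over \<open>a\<close>, the frequency \<open>0\<close> gives the main term, and a frequency \<open>j \<noteq> 0\<close> contributes at most
  the product of \<open>1 / \<parallel>j \<cdot> row u A\<parallel>\<close> over \<open>u\<close>, up to the size of the coefficient. By hypothesis the
  points \<open>(j \<cdot> row u A)\<^sub>u\<close> modulo 1 are multiplicatively separated, so a dyadic box of volume \<open>V\<close> contains
  \<open>O(V J\<^sup>\<omega>)\<close> of those with \<open>|j| < J\<close>; as there are \<open>O((log J)\<^sup>d)\<close> relevant boxes, all nonzero frequencies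
  together contribute \<open>O(J\<^sup>\<omega> (log J)\<^sup>d)\<close>.

  The polynomials are discrete convolutions of an interval of length \<open>2 (1 \<plusminus> \<eta>) \<delta>\<close> with a Jackson kernel of
  degree about \<open>1 / (\<eta>\<^sup>2 \<delta>)\<close>, which has second moment \<open>O(J\<^sup>-\<^sup>2)\<close>. By Chebyshev's inequality the wider one
  is at least \<open>1 - \<eta>\<^sup>2 / 2\<close> on the box, and the narrower one is at most \<open>(\<eta>\<^sup>2 / 2) (\<delta> / \<parallel>x\<parallel>)\<^sup>2\<close> outside;
  this tail is absorbed by a nonnegative trigonometric polynomial, the sum of two shifted Fejer kernels
  of degree about \<open>1 / \<delta>\<close>.
\<close>

section \<open>Sums over multiplicatively separated points\<close>

text \<open>Pigeonhole: cut into cells of length \<open>g\<close>, the interval has at most one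
  value of \<open>f\<close> in each cell, so the cell index \<open>h\<close> is injective.\<close>

lemma card_separated_le:
  fixes f :: "'a \<Rightarrow> real"
  assumes "finite X" and "g > 0" and "0 \<le> l"
    and bounds: "\<And>x. x \<in> X \<Longrightarrow> a \<le> f x \<and> f x \<le> a + l"
    and sep: "\<And>x x'. x \<in> X \<Longrightarrow> x' \<in> X \<Longrightarrow> x \<noteq> x' \<Longrightarrow> \<bar>f x - f x'\<bar> \<ge> g"
  shows "real (card X) \<le> l / g + 1"
proof -
  define h where "h x = \<lfloor>(f x - a) / g\<rfloor>" for x
  have inj: "inj_on h X"
  proof (rule inj_onI, rule ccontr)
    fix x x' assume xx: "x \<in> X" "x' \<in> X" "h x = h x'" "x \<noteq> x'"
    have "\<bar>(f x - a) / g - (f x' - a) / g\<bar> < 1"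
      using xx(3) unfolding h_def by linarith
    moreover have "(f x - a) / g - (f x' - a) / g = (f x - f x') / g"
      by (simp add: diff_divide_distrib)
    ultimately have "\<bar>f x - f x'\<bar> < g"
      using \<open>g > 0\<close> by (simp add: abs_divide)
    with sep[OF xx(1,2,4)] show False by simp
  qed
  have sub: "h ` X \<subseteq> {0..\<lfloor>l / g\<rfloor>}"
  proof
    fix z assume "z \<in> h ` X"
    then obtain x where x: "x \<in> X" "z = h x" by auto
    have "0 \<le> (f x - a) / g" "(f x - a) / g \<le> l / g"
      using bounds[OF x(1)] \<open>g > 0\<close> by (auto intro!: divide_right_mono)
    then show "z \<in> {0..\<lfloor>l / g\<rfloor>}"
      unfolding x(2) h_def by (auto intro: floor_mono)
  qed
  have "card X = card (h ` X)" using inj by (simp add: card_image)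
  also have "\<dots> \<le> card {0..\<lfloor>l / g\<rfloor>}" using sub by (intro card_mono) auto
  finally have "real (card X) \<le> real (nat (\<lfloor>l / g\<rfloor> + 1))" by simp
  moreover have "0 \<le> l / g" using assms by simp
  ultimately show ?thesis by linarith
qed

text \<open>With signs fixed, two points of the class differ by at most \<open>b u\<close> in each
  coordinate. Multiplicative separation then forces a genuine gap along any single coordinate, where
  the one-dimensional count applies.\<close>

lemma dyadic_class_card_le:
  fixes y :: "'a \<Rightarrow> 'd::finite \<Rightarrow> real" and b :: "'d \<Rightarrow> real" and s :: "'d \<Rightarrow> bool"
  assumes "finite X" and "lam > 0" and b: "\<And>u. b u > 0"
    and dy: "\<And>j u. j \<in> X \<Longrightarrow> b u \<le> \<bar>y j u\<bar> \<and> \<bar>y j u\<bar> \<le> 2 * b u \<and> (y j u > 0 \<longleftrightarrow> s u)"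
    and low: "\<And>j. j \<in> X \<Longrightarrow> lam \<le> (\<Prod>u\<in>UNIV. \<bar>y j u\<bar>)"
    and sep: "\<And>j j'. j \<in> X \<Longrightarrow> j' \<in> X \<Longrightarrow> j \<noteq> j' \<Longrightarrow> lam \<le> (\<Prod>u\<in>UNIV. \<bar>y j u - y j' u\<bar>)"
  shows "real (card X) \<le> (2 ^ CARD('d) + 1) * (\<Prod>u\<in>UNIV. b u) / lam"
proof (cases "X = {}")
  case True
  then show ?thesis using \<open>lam > 0\<close> b by (auto intro!: divide_nonneg_pos mult_nonneg_nonneg prod_nonneg simp: less_imp_le)
next
  case False
  define V where "V = (\<Prod>u\<in>UNIV. b u)"
  \<comment> \<open>An arbitrary coordinate, along which the points will be counted.\<close>
  obtain u0 :: 'd where True by simp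
  define W where "W = (\<Prod>u\<in>UNIV - {u0}. b u)"
  have W: "W > 0" unfolding W_def using b by (simp add: prod_pos)
  have VW: "V = b u0 * W" unfolding V_def W_def by (rule prod.remove) auto
  have diff: "\<bar>y j u - y j' u\<bar> \<le> b u" if "j \<in> X" "j' \<in> X" for j j' u
    using dy[OF that(1), of u] dy[OF that(2), of u] b[of u] by (cases "s u") auto
  \<comment> \<open>Left end of an interval of length \<open>b u0\<close> containing all the values;
    negative ones lie between \<open>- 2 * b u0\<close> and \<open>- b u0\<close>.\<close>
  define a where "a = (if s u0 then b u0 else - 2 * b u0)"
  have "real (card X) \<le> b u0 / (lam / W) + 1"
  proof (rule card_separated_le[where f = "\<lambda>j. y j u0" and a = a])
    show "finite X" by fact
    show "lam / W > 0" using W \<open>lam > 0\<close> by simp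
    show "0 \<le> b u0" using b[of u0] by simp
    show "a \<le> y j u0 \<and> y j u0 \<le> a + b u0" if "j \<in> X" for j
      using dy[OF that, of u0] b[of u0] unfolding a_def by auto
    show "lam / W \<le> \<bar>y j u0 - y j' u0\<bar>" if "j \<in> X" "j' \<in> X" "j \<noteq> j'" for j j'
    proof -
      have "lam \<le> (\<Prod>u\<in>UNIV. \<bar>y j u - y j' u\<bar>)" by (rule sep[OF that])
      also have "\<dots> = \<bar>y j u0 - y j' u0\<bar> * (\<Prod>u\<in>UNIV - {u0}. \<bar>y j u - y j' u\<bar>)"
        by (rule prod.remove) auto
      also have "\<dots> \<le> \<bar>y j u0 - y j' u0\<bar> * W"
        unfolding W_def by (intro mult_left_mono prod_mono) (auto intro: diff that)
      finally show ?thesis using W by (simp add: divide_le_eq)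
    qed
  qed
  also have "b u0 / (lam / W) = V / lam" by (simp add: VW)
  finally have card: "real (card X) \<le> V / lam + 1" .
  \<comment> \<open>A single point of the class already gives
    \<open>lam \<le> 2 ^ CARD('d) * V\<close>, which absorbs the additive 1 of the count.\<close>
  obtain j where j: "j \<in> X" using False by auto
  have "lam \<le> (\<Prod>u\<in>UNIV. \<bar>y j u\<bar>)" by (rule low[OF j])
  also have "\<dots> \<le> (\<Prod>u\<in>UNIV. 2 * b u)" using dy[OF j] by (intro prod_mono) auto
  also have "\<dots> = 2 ^ CARD('d) * V" unfolding V_def by (simp add: prod.distrib)
  finally have "1 \<le> 2 ^ CARD('d) * V / lam" using \<open>lam > 0\<close> by simp
  with card show ?thesis
    unfolding V_def[symmetric] by (simp add: distrib_right add_divide_distrib)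
qed

text \<open>Sort the points by dyadic size and sign of every coordinate. In a class of volume
  \<open>V\<close> each summand is at most \<open>1 / V\<close> while the number of points is
  \<open>O(V / lam)\<close>, so \<open>V\<close> cancels and every class contributes equally; only
  the number of classes remains.\<close>

lemma sum_inverse_prod_le:
  fixes y :: "'a \<Rightarrow> 'd::finite \<Rightarrow> real"
  assumes fin: "finite X" and "lam > 0"
    and small: "\<And>j u. j \<in> X \<Longrightarrow> \<bar>y j u\<bar> \<le> 1 / 2"
    and low: "\<And>j. j \<in> X \<Longrightarrow> lam \<le> (\<Prod>u\<in>UNIV. \<bar>y j u\<bar>)"
    and sep: "\<And>j j'. j \<in> X \<Longrightarrow> j' \<in> X \<Longrightarrow> j \<noteq> j' \<Longrightarrow> lam \<le> (\<Prod>u\<in>UNIV. \<bar>y j u - y j' u\<bar>)"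
    and L: "L \<ge> 0" "log 2 (1 / lam) \<le> L"
  shows "(\<Sum>j\<in>X. \<Prod>u\<in>UNIV. 1 / \<bar>y j u\<bar>) \<le> (2 ^ CARD('d) + 1) / lam * (2 * (L + 1)) ^ CARD('d)"
proof -
  define k where "k j u = \<lfloor>log 2 \<bar>y j u\<bar>\<rfloor>" for j u
  define cls where "cls j = (\<lambda>u. (k j u, y j u > 0))" for j
  \<comment> \<open>The exponent -1 comes from the upper bound 1/2, and the lower end from
    \<open>lam\<close> being a lower bound for each single coordinate.\<close>
  define K where "K = {- \<lceil>L\<rceil>..-1::int}"
  define Z where "Z = (UNIV :: 'd set) \<rightarrow>\<^sub>E (K \<times> (UNIV :: bool set))"
  \<comment> \<open>The other factors of the product are at most 1, so the bound for the product
    passes to each factor.\<close>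
  have ylow: "lam \<le> \<bar>y j u\<bar>" if "j \<in> X" for j u
  proof -
    have "lam \<le> (\<Prod>u\<in>UNIV. \<bar>y j u\<bar>)" by (rule low[OF that])
    also have "\<dots> = \<bar>y j u\<bar> * (\<Prod>v\<in>UNIV - {u}. \<bar>y j v\<bar>)" by (rule prod.remove) auto
    also have "\<dots> \<le> \<bar>y j u\<bar> * 1"
    proof (intro mult_left_mono prod_le_1)
      fix v show "0 \<le> \<bar>y j v\<bar> \<and> \<bar>y j v\<bar> \<le> 1" using small[OF that, of v] by auto
    qed auto
    finally show ?thesis by simp
  qed
  have ypos: "\<bar>y j u\<bar> > 0" if "j \<in> X" for j u
    using ylow[OF that, of u] \<open>lam > 0\<close> by linarith
  have kK: "k j u \<in> K" if j: "j \<in> X" for j u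
  proof -
    have "log 2 \<bar>y j u\<bar> \<le> log 2 (1 / 2)"
      using small[OF j, of u] ypos[OF j, of u] by (subst log_le_cancel_iff) auto
    then have 1: "log 2 \<bar>y j u\<bar> \<le> -1" by (simp add: log_divide)
    have "log 2 lam \<le> log 2 \<bar>y j u\<bar>"
      using ylow[OF j, of u] ypos[OF j, of u] \<open>lam > 0\<close> by (subst log_le_cancel_iff) auto
    moreover have "log 2 (1 / lam) = - log 2 lam" using \<open>lam > 0\<close> by (simp add: log_divide)
    ultimately have 2: "log 2 \<bar>y j u\<bar> \<ge> - L" using L by linarith
    show ?thesis using 1 2 unfolding k_def K_def by (simp, linarith)
  qed
  have dy: "2 powr k j u \<le> \<bar>y j u\<bar> \<and> \<bar>y j u\<bar> \<le> 2 * 2 powr k j u" if j: "j \<in> X" for j u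
  proof
    have "2 powr k j u \<le> 2 powr (log 2 \<bar>y j u\<bar>)" unfolding k_def by (intro powr_mono) auto
    then show "2 powr k j u \<le> \<bar>y j u\<bar>" using ypos[OF j, of u] by simp
    have "2 powr (log 2 \<bar>y j u\<bar>) \<le> 2 powr (1 + k j u)" unfolding k_def by (intro powr_mono) linarith+
    then show "\<bar>y j u\<bar> \<le> 2 * 2 powr k j u" using ypos[OF j, of u] by (simp add: powr_add)
  qed
  have finZ: "finite Z" unfolding Z_def K_def by (intro finite_PiE) auto
  have clsZ: "cls ` X \<subseteq> Z" unfolding Z_def cls_def using kK by auto
  have "card Z = (card K * 2) ^ CARD('d)"
    unfolding Z_def by (simp add: card_PiE card_cartesian_product)
  moreover have "real (card K) \<le> L + 1"
    unfolding K_def using L(1) by simp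
  ultimately have cardZ: "real (card Z) \<le> (2 * (L + 1)) ^ CARD('d)"
    using power_mono[of "real (card K * 2)" "2 * (L + 1)" "CARD('d)"] by simp
  have one: "(\<Sum>j\<in>{j\<in>X. cls j = z}. \<Prod>u\<in>UNIV. 1 / \<bar>y j u\<bar>) \<le> (2 ^ CARD('d) + 1) / lam" (is "?l \<le> ?r") for z
  proof -
    let ?Y = "{j\<in>X. cls j = z}"
    define b where "b u = 2 powr real_of_int (fst (z u))" for u
    define V where "V = (\<Prod>u\<in>UNIV. b u)"
    have bpos: "b u > 0" for u unfolding b_def by simp
    have V: "V > 0" unfolding V_def by (intro prod_pos) (auto simp: bpos)
    have bk: "b u = 2 powr k j u" "snd (z u) = (y j u > 0)" if "j \<in> ?Y" for j u
      using that unfolding b_def cls_def by auto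
    have c: "real (card ?Y) \<le> (2 ^ CARD('d) + 1) * V / lam"
      unfolding V_def
    proof (rule dyadic_class_card_le[where y = y and s = "\<lambda>u. snd (z u)"])
      show "b u \<le> \<bar>y j u\<bar> \<and> \<bar>y j u\<bar> \<le> 2 * b u \<and> (0 < y j u) = snd (z u)" if "j \<in> ?Y" for j u
        using dy[of j u] bk[OF that, of u] that by auto
    qed (use fin \<open>lam > 0\<close> bpos low sep in auto)
    have "?l \<le> (\<Sum>j\<in>?Y. 1 / V)"
    proof (rule sum_mono)
      fix j assume j: "j \<in> ?Y"
      have "(\<Prod>u\<in>UNIV. 1 / \<bar>y j u\<bar>) \<le> (\<Prod>u\<in>UNIV. 1 / b u)"
        using dy[of j] bk(1)[OF j] j bpos ypos by (intro prod_mono) (auto intro!: divide_left_mono)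
      then show "(\<Prod>u\<in>UNIV. 1 / \<bar>y j u\<bar>) \<le> 1 / V" unfolding V_def by (simp add: prod_dividef)
    qed
    also have "\<dots> = real (card ?Y) / V" by simp
    also have "\<dots> \<le> ((2 ^ CARD('d) + 1) * V / lam) / V" using c V by (intro divide_right_mono) auto
    also have "\<dots> = ?r" using V by simp
    finally show ?thesis .
  qed
  have "(\<Sum>j\<in>X. \<Prod>u\<in>UNIV. 1 / \<bar>y j u\<bar>) = (\<Sum>z\<in>Z. \<Sum>j\<in>{j\<in>X. cls j = z}. \<Prod>u\<in>UNIV. 1 / \<bar>y j u\<bar>)"
    by (rule sum.group[symmetric]) (use fin finZ clsZ in auto)
  also have "\<dots> \<le> (\<Sum>z\<in>Z. (2 ^ CARD('d) + 1) / lam)" by (intro sum_mono one)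
  also have "\<dots> = (2 ^ CARD('d) + 1) / lam * real (card Z)" by simp
  also have "\<dots> \<le> (2 ^ CARD('d) + 1) / lam * (2 * (L + 1)) ^ CARD('d)"
    using cardZ \<open>lam > 0\<close> by (intro mult_left_mono) auto
  finally show ?thesis .
qed

section \<open>Trigonometric polynomials\<close>

lemma int_dist_le_half: "int_dist x \<le> 1 / 2"
  unfolding int_dist_def using of_int_round_abs_le[of x] by (simp add: abs_minus_commute)

lemma int_dist_nonneg [simp]: "0 \<le> int_dist x"
  unfolding int_dist_def by simp

lemma int_dist_le: "int_dist x \<le> \<bar>x - of_int k\<bar>"
  unfolding int_dist_def by (rule round_diff_minimal)

lemma int_dist_triangle: "int_dist x \<le> int_dist y + int_dist (x - y)"
proof -
  have "int_dist x \<le> \<bar>x - of_int (round y + round (x - y))\<bar>" by (rule int_dist_le)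
  also have "\<dots> \<le> \<bar>y - of_int (round y)\<bar> + \<bar>(x - y) - of_int (round (x - y))\<bar>" by simp
  finally show ?thesis unfolding int_dist_def .
qed

lemma int_dist_minus: "int_dist (x - y) = int_dist (y - x)"
proof -
  have "int_dist (x - y) \<le> int_dist (y - x)" for x y
    using int_dist_le[of "x - y" "- round (y - x)"] unfolding int_dist_def by simp
  then show ?thesis by (intro antisym)
qed

text \<open>Jordan's inequality: the sine is concave on this interval and hence lies above its
  chord.\<close>

lemma sin_ge_jordan:
  fixes x :: real
  assumes "0 \<le> x" "x \<le> pi / 2"
  shows "2 * x / pi \<le> sin x"
proof -
  have conv: "convex_on {0..pi/2} (\<lambda>x::real. - sin x)"
  proof (rule f''_ge0_imp_convex)
    show "((\<lambda>x. - sin x) has_real_derivative - cos x) (at x)" for x :: real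
      by (auto intro!: derivative_eq_intros)
    show "((\<lambda>x. - cos x) has_real_derivative sin x) (at x)" for x :: real
      by (auto intro!: derivative_eq_intros)
    show "0 \<le> sin x" if "x \<in> {0..pi/2}" for x :: real
      using that by (auto intro!: sin_ge_zero)
  qed auto
  define t where "t = 2 * x / pi"
  have t: "0 \<le> t" "t \<le> 1" using assms unfolding t_def by (auto simp: divide_simps)
  have "- sin ((1 - t) *\<^sub>R 0 + t *\<^sub>R (pi / 2)) \<le> (1 - t) * (- sin 0) + t * (- sin (pi / 2))"
    by (rule convex_onD[OF conv]) (use t in auto)
  moreover have "t *\<^sub>R (pi / 2) = x" unfolding t_def by simp
  ultimately show ?thesis by (simp add: t_def)
qed

text \<open>Subtracting an integer multiple of pi changes the sine at most by a sign, and the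
  remaining argument lies where the sine of its absolute value is nonnegative.\<close>

lemma abs_sin_pi_int_dist: "\<bar>sin (pi * x)\<bar> = sin (pi * int_dist x)"
proof -
  define n where "n = round x"
  have nz: "sin (pi * of_int n) = 0" by (metis mult.commute sin_zero_iff_int2)
  then have "\<bar>cos (pi * of_int n)\<bar> = 1" using sin_zero_abs_cos_one by blast
  then have "\<bar>sin (pi * x)\<bar> = \<bar>sin (pi * x) * cos (pi * of_int n) - cos (pi * x) * sin (pi * of_int n)\<bar>"
    by (simp add: nz abs_mult)
  also have "\<dots> = \<bar>sin (pi * (x - of_int n))\<bar>"
    by (simp only: sin_diff[symmetric] right_diff_distrib)
  also have "\<dots> = \<bar>sin (pi * int_dist x)\<bar>"
  proof -
    have "\<bar>sin (pi * z)\<bar> = \<bar>sin (pi * \<bar>z\<bar>)\<bar>" for z :: real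
      by (cases "0 \<le> z") auto
    then show ?thesis unfolding int_dist_def n_def .
  qed
  also have "\<dots> = sin (pi * int_dist x)"
  proof -
    have "pi * int_dist x \<le> pi * 1" using int_dist_le_half[of x] by (intro mult_left_mono) auto
    then have "0 \<le> sin (pi * int_dist x)" by (intro sin_ge_zero) auto
    then show ?thesis by simp
  qed
  finally show ?thesis .
qed

lemma abs_sin_pi_ge: "2 * int_dist x \<le> \<bar>sin (pi * x)\<bar>"
  using sin_ge_jordan[of "pi * int_dist x"] int_dist_le_half[of x]
  by (simp add: abs_sin_pi_int_dist)

lemma abs_sin_pi_le: "\<bar>sin (pi * x)\<bar> \<le> pi * int_dist x"
  unfolding abs_sin_pi_int_dist by (intro sin_x_le_x) auto

section \<open>The additive character e(x) = exp(2 pi i x) and its geometric sums\<close>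

definition unit_exp :: "real \<Rightarrow> complex" where
  "unit_exp x = cis (2 * pi * x)"

lemma unit_exp_add: "unit_exp (x + y) = unit_exp x * unit_exp y"
  unfolding unit_exp_def by (simp add: cis_mult distrib_left)

lemma unit_exp_0 [simp]: "unit_exp 0 = 1"
  unfolding unit_exp_def by simp

lemma norm_unit_exp [simp]: "cmod (unit_exp x) = 1"
  unfolding unit_exp_def by simp

lemma unit_exp_power: "unit_exp x ^ n = unit_exp (real n * x)"
  unfolding unit_exp_def by (simp add: Complex.DeMoivre mult_ac)

lemma unit_exp_of_int [simp]: "unit_exp (of_int k) = 1"
  unfolding unit_exp_def by (simp add: cis_multiple_2pi)

lemma unit_exp_sum: "finite S \<Longrightarrow> unit_exp (\<Sum>i\<in>S. f i) = (\<Prod>i\<in>S. unit_exp (f i))"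
  by (induction S rule: finite_induct) (auto simp: unit_exp_add)

lemma cnj_unit_exp: "cnj (unit_exp x) = unit_exp (- x)"
  unfolding unit_exp_def by (simp add: cis_cnj)

lemma norm_1_minus_unit_exp: "cmod (1 - unit_exp x) = 2 * \<bar>sin (pi * x)\<bar>"
  using dist_exp_i_1[of "2 * pi * x"]
  by (simp add: unit_exp_def cis_conv_exp norm_minus_commute)

lemma unit_exp_eq_1_iff: "unit_exp x = 1 \<longleftrightarrow> x \<in> \<int>"
proof
  assume "unit_exp x = 1"
  then have "sin (pi * x) = 0" using norm_1_minus_unit_exp[of x] by simp
  then obtain i :: int where "pi * x = of_int i * pi" by (auto simp: sin_zero_iff_int2)
  then have "x = of_int i" by simp
  then show "x \<in> \<int>" by simp
qed (auto elim!: Ints_cases)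

text \<open>One-sided form of the Dirichlet kernel; for odd \<open>J\<close> it differs from the
  symmetric one only by a factor of modulus 1.\<close>

definition dirichlet :: "nat \<Rightarrow> real \<Rightarrow> complex" where
  "dirichlet J x = (\<Sum>r<J. unit_exp (real r * x))"

lemma dirichlet_mult: "(1 - unit_exp x) * dirichlet J x = 1 - unit_exp (real J * x)"
  unfolding dirichlet_def by (simp add: unit_exp_power[symmetric] one_diff_power_eq)

lemma norm_dirichlet_sin: "cmod (dirichlet J x) * \<bar>sin (pi * x)\<bar> = \<bar>sin (pi * (real J * x))\<bar>"
proof -
  have "cmod (1 - unit_exp x) * cmod (dirichlet J x) = cmod (1 - unit_exp (real J * x))"
    by (simp add: dirichlet_mult flip: norm_mult)
  then show ?thesis unfolding norm_1_minus_unit_exp by (simp add: mult.commute)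
qed

text \<open>The summed geometric series has modulus
  \<open>\<bar>sin (pi * J * x)\<bar> / \<bar>sin (pi * x)\<bar>\<close>; the numerator is at most 1
  and Jordan's inequality bounds the denominator from below.\<close>

lemma norm_dirichlet_le:
  assumes "int_dist x > 0"
  shows "cmod (dirichlet J x) \<le> 1 / int_dist x"
proof -
  have "cmod (dirichlet J x) * int_dist x \<le> cmod (dirichlet J x) * \<bar>sin (pi * x)\<bar>"
    using abs_sin_pi_ge[of x] assms by (intro mult_left_mono) auto
  also have "\<dots> \<le> 1" unfolding norm_dirichlet_sin by simp
  finally show ?thesis using assms by (simp add: pos_le_divide_eq)
qed

text \<open>Records what an exponential sum needs to know of a real trigonometric polynomial: degree
  below \<open>J\<close>, a uniform bound \<open>B\<close> for the coefficients, and the mean value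
  \<open>c0\<close>, which produces the main term.\<close>

definition trig_poly :: "nat \<Rightarrow> real \<Rightarrow> real \<Rightarrow> (real \<Rightarrow> real) \<Rightarrow> bool" where
  "trig_poly J B c0 p \<longleftrightarrow> (\<exists>c :: int \<Rightarrow> complex. c 0 = of_real c0 \<and> (\<forall>j. cmod (c j) \<le> B) \<and>
     (\<forall>x. of_real (p x) = (\<Sum>j\<in>{- int J<..<int J}. c j * unit_exp (of_int j * x))))"

lemma trig_poly_mono:
  assumes "trig_poly J B c0 p" and "J \<le> J'" and "B \<le> B'" and "J > 0"
  shows "trig_poly J' B' c0 p"
proof -
  obtain c where c: "c 0 = of_real c0" "\<And>j. cmod (c j) \<le> B"
    "\<And>x. of_real (p x) = (\<Sum>j\<in>{- int J<..<int J}. c j * unit_exp (of_int j * x))"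
    using assms(1) unfolding trig_poly_def by blast
  have B: "0 \<le> B" using c(2)[of 0] norm_ge_zero[of "c 0"] by linarith
  \<comment> \<open>The definition leaves coefficients outside the old range arbitrary, so they are
    set to zero here; \<open>J > 0\<close> keeps index 0 inside that range and preserves the
    mean.\<close>
  define c' where "c' j = (if j \<in> {- int J<..<int J} then c j else 0)" for j
  have "(\<Sum>j\<in>{- int J'<..<int J'}. c' j * unit_exp (of_int j * x)) = of_real (p x)" for x
    unfolding c(3) by (rule sum.mono_neutral_cong_right) (use assms in \<open>auto simp: c'_def\<close>)
  moreover have "cmod (c' j) \<le> B'" for j using c(2)[of j] B assms(3) by (auto simp: c'_def)
  ultimately show ?thesis unfolding trig_poly_def using assms(4) c(1)
    by (intro exI[of _ c']) (auto simp: c'_def)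
qed

text \<open>Translation multiplies each coefficient by a number of modulus 1, which is 1 at
  frequency 0.\<close>

lemma trig_poly_shift:
  assumes "trig_poly J B c0 p"
  shows "trig_poly J B c0 (\<lambda>x. p (x - t))"
proof -
  obtain c where c: "c 0 = of_real c0" "\<And>j. cmod (c j) \<le> B"
    "\<And>x. of_real (p x) = (\<Sum>j\<in>{- int J<..<int J}. c j * unit_exp (of_int j * x))"
    using assms unfolding trig_poly_def by blast
  show ?thesis unfolding trig_poly_def
    by (rule exI[of _ "\<lambda>j. c j * unit_exp (- (of_int j * t))"])
      (auto simp: c norm_mult right_diff_distrib mult_ac unit_exp_add[symmetric] intro!: sum.cong)
qed

lemma trig_poly_sum:
  assumes "finite S" and "\<And>r. r \<in> S \<Longrightarrow> trig_poly J B c0 (p r)"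
  shows "trig_poly J (real (card S) * B) (real (card S) * c0) (\<lambda>x. \<Sum>r\<in>S. p r x)"
proof -
  have "\<forall>r\<in>S. \<exists>c :: int \<Rightarrow> complex. c 0 = of_real c0 \<and> (\<forall>j. cmod (c j) \<le> B) \<and>
     (\<forall>x. of_real (p r x) = (\<Sum>j\<in>{- int J<..<int J}. c j * unit_exp (of_int j * x)))"
    using assms(2) unfolding trig_poly_def by blast
  from bchoice[OF this] obtain c where c: "\<And>r. r \<in> S \<Longrightarrow> c r 0 = of_real c0"
    "\<And>r j. r \<in> S \<Longrightarrow> cmod (c r j) \<le> B"
    "\<And>r x. r \<in> S \<Longrightarrow> of_real (p r x) = (\<Sum>j\<in>{- int J<..<int J}. c r j * unit_exp (of_int j * x))"
    by metis
  have "of_real (\<Sum>r\<in>S. p r x) = (\<Sum>j\<in>{- int J<..<int J}. (\<Sum>r\<in>S. c r j) * unit_exp (of_int j * x))" for x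
    by (simp add: c(3) sum_distrib_right) (rule sum.swap)
  moreover have "cmod (\<Sum>r\<in>S. c r j) \<le> real (card S) * B" for j
    by (rule sum_norm_bound) (use c(2) in auto)
  ultimately show ?thesis unfolding trig_poly_def
    by (intro exI[of _ "\<lambda>j. \<Sum>r\<in>S. c r j"]) (auto simp: c(1))
qed

lemma trig_poly_scale:
  assumes "trig_poly J B c0 p" and "0 \<le> t"
  shows "trig_poly J (t * B) (t * c0) (\<lambda>x. t * p x)"
proof -
  obtain c where c: "c 0 = of_real c0" "\<And>j. cmod (c j) \<le> B"
    "\<And>x. of_real (p x) = (\<Sum>j\<in>{- int J<..<int J}. c j * unit_exp (of_int j * x))"
    using assms(1) unfolding trig_poly_def by blast
  show ?thesis unfolding trig_poly_def
    by (rule exI[of _ "\<lambda>j. of_real t * c j"])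
      (use assms(2) in \<open>auto simp: c norm_mult sum_distrib_left mult.assoc intro!: mult_left_mono\<close>)
qed

text \<open>Exact quadrature: summing over the \<open>M\<close> equally spaced translates kills
  every frequency not divisible by \<open>M\<close>, and in degree below \<open>M\<close> only
  frequency 0 survives.\<close>

lemma trig_poly_sum_shifts:
  assumes "trig_poly M B c0 p" and "M > 0"
  shows "(\<Sum>r<M. p (x - real r / real M)) = real M * c0"
proof -
  obtain c where c: "c 0 = of_real c0" "\<And>j. cmod (c j) \<le> B"
    "\<And>x. of_real (p x) = (\<Sum>j\<in>{- int M<..<int M}. c j * unit_exp (of_int j * x))"
    using assms(1) unfolding trig_poly_def by blast
  have vanish: "(\<Sum>r<M. unit_exp (of_int j * (x - real r / real M))) = 0"
    if "j \<in> {- int M<..<int M}" "j \<noteq> 0" for j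
  proof -
    define z where "z = unit_exp (- (of_int j / real M))"
    have "- (of_int j / real M) \<notin> \<int>"
    proof
      assume "- (of_int j / real M) \<in> \<int>"
      then obtain k where k: "- (of_int j / real M) = of_int k" by (elim Ints_cases)
      then have "real_of_int j = of_int (- k * int M)" using assms(2) by (simp add: field_simps)
      then have "j = - k * int M" by linarith
      then have "int M dvd j" by simp
      with that(2) have "int M \<le> \<bar>j\<bar>" using dvd_imp_le_int[of j "int M"] by simp
      with that(1) show False by auto
    qed
    then have "z \<noteq> 1" unfolding z_def unit_exp_eq_1_iff .
    have "z ^ M = unit_exp (of_int (- j))" unfolding z_def unit_exp_power using assms(2) by simp
    then have "z ^ M = 1" by (simp only: unit_exp_of_int)
    with \<open>z \<noteq> 1\<close> have "(\<Sum>r<M. z ^ r) = 0" by (simp add: sum_gp_strict)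
    moreover have "unit_exp (of_int j * (x - real r / real M)) = unit_exp (of_int j * x) * z ^ r" for r
      unfolding z_def unit_exp_power unit_exp_add[symmetric] by (simp add: field_simps)
    ultimately show ?thesis by (simp add: sum_distrib_left[symmetric])
  qed
  have "of_real (\<Sum>r<M. p (x - real r / real M))
      = (\<Sum>j\<in>{- int M<..<int M}. c j * (\<Sum>r<M. unit_exp (of_int j * (x - real r / real M))))"
    by (simp add: c(3) sum_distrib_left) (rule sum.swap)
  also have "\<dots> = (\<Sum>j\<in>{0}. c j * (\<Sum>r<M. unit_exp (of_int j * (x - real r / real M))))"
    by (rule sum.mono_neutral_right) (use assms(2) vanish in auto)
  also have "\<dots> = of_real (real M * c0)" by (simp add: c(1))
  finally show ?thesis using of_real_eq_iff by blast
qed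

section \<open>Fejer and Jackson kernels\<close>

text \<open>The Fejer kernel, normalised to have mean 1.\<close>

definition fejer :: "nat \<Rightarrow> real \<Rightarrow> real" where
  "fejer J x = (cmod (dirichlet J x))\<^sup>2 / real J"

lemma fejer_nonneg [simp]: "0 \<le> fejer J x"
  unfolding fejer_def by simp

lemma fejer_sin: "fejer J x * (sin (pi * x))\<^sup>2 = (sin (pi * (real J * x)))\<^sup>2 / real J"
proof -
  have "(cmod (dirichlet J x) * \<bar>sin (pi * x)\<bar>)\<^sup>2 = (sin (pi * (real J * x)))\<^sup>2"
    unfolding norm_dirichlet_sin by simp
  then show ?thesis unfolding fejer_def by (simp add: power_mult_distrib)
qed

lemma fejer_at_0: "J > 0 \<Longrightarrow> fejer J 0 = real J"
  unfolding fejer_def dirichlet_def by (simp add: power2_eq_square)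

text \<open>Expanding the squared modulus, the coefficient of \<open>j\<close> counts the pairs with
  difference \<open>j\<close>, divided by \<open>J\<close>. Swapping the pair gives the symmetry,
  and projecting to one entry gives the bound 1.\<close>

lemma fejer_expansion:
  assumes "J > 0"
  obtains c :: "int \<Rightarrow> real" where "c 0 = 1" "\<And>j. 0 \<le> c j" "\<And>j. c j \<le> 1" "\<And>j. c (- j) = c j"
    "\<And>x. of_real (fejer J x) = (\<Sum>j\<in>{- int J<..<int J}. of_real (c j) * unit_exp (of_int j * x))"
proof
  define P where "P j = {rs \<in> {..<J} \<times> {..<J}. int (fst rs) - int (snd rs) = j}" for j
  define c where "c j = real (card (P j)) / real J" for j
  have "card (P 0) = card ((\<lambda>r. (r, r)) ` {..<J})"
    by (rule arg_cong[where f = card]) (auto simp: P_def)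
  also have "\<dots> = J" by (simp add: card_image inj_on_def)
  finally show "c 0 = 1" unfolding c_def using assms by simp
  show "0 \<le> c j" for j unfolding c_def by simp
  show "c j \<le> 1" for j
  proof -
    have "card (P j) \<le> card {..<J}"
      by (rule card_inj_on_le[where f = fst]) (auto simp: P_def inj_on_def)
    then show ?thesis unfolding c_def using assms by simp
  qed
  show "c (- j) = c j" for j
  proof -
    have "card (P (- j)) = card (prod.swap ` P j)"
      by (rule arg_cong[where f = card]) (auto simp: P_def image_iff)
    also have "\<dots> = card (P j)" by (rule card_image) auto
    finally show ?thesis unfolding c_def by simp
  qed
  show "of_real (fejer J x) = (\<Sum>j\<in>{- int J<..<int J}. of_real (c j) * unit_exp (of_int j * x))" for x
  proof -
    let ?g = "\<lambda>rs. unit_exp ((real (fst rs) - real (snd rs)) * x)"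
    have "of_real ((cmod (dirichlet J x))\<^sup>2) = dirichlet J x * cnj (dirichlet J x)"
      by (simp only: complex_norm_square)
    also have "\<dots> = (\<Sum>r<J. \<Sum>s<J. unit_exp (real r * x) * unit_exp (- (real s * x)))"
      unfolding dirichlet_def by (simp add: sum_product cnj_unit_exp)
    also have "\<dots> = (\<Sum>rs\<in>{..<J} \<times> {..<J}. ?g rs)"
      by (simp add: sum.cartesian_product unit_exp_add[symmetric] left_diff_distrib case_prod_unfold)
    also have "\<dots> = (\<Sum>j\<in>{- int J<..<int J}. \<Sum>rs\<in>P j. ?g rs)"
      unfolding P_def by (rule sum.group[symmetric]) auto
    also have "\<dots> = (\<Sum>j\<in>{- int J<..<int J}. of_nat (card (P j)) * unit_exp (of_int j * x))"
    proof (rule sum.cong[OF refl])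
      fix j
      have "?g rs = unit_exp (of_int j * x)" if "rs \<in> P j" for rs
      proof -
        have "int (fst rs) - int (snd rs) = j" using that unfolding P_def by simp
        then have "real (fst rs) - real (snd rs) = of_int j" by linarith
        then show ?thesis by simp
      qed
      then show "(\<Sum>rs\<in>P j. ?g rs) = of_nat (card (P j)) * unit_exp (of_int j * x)" by simp
    qed
    finally have "of_real ((cmod (dirichlet J x))\<^sup>2) = (\<Sum>j\<in>{- int J<..<int J}. of_nat (card (P j)) * unit_exp (of_int j * x))" .
    then show ?thesis unfolding fejer_def c_def
      by (simp add: sum_divide_distrib)
  qed
qed

lemma trig_poly_fejer:
  assumes "J > 0"
  shows "trig_poly J 1 1 (fejer J)"
proof -
  obtain c :: "int \<Rightarrow> real" where c: "c 0 = 1" "\<And>j. 0 \<le> c j" "\<And>j. c j \<le> 1"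
    "\<And>x. of_real (fejer J x) = (\<Sum>j\<in>{- int J<..<int J}. of_real (c j) * unit_exp (of_int j * x))"
    using fejer_expansion[OF assms] by metis
  show ?thesis unfolding trig_poly_def
    by (rule exI[of _ "\<lambda>j. of_real (c j)"]) (simp add: c)
qed

text \<open>The squared Fejer kernel is Jackson's kernel up to normalisation. Its coefficients are
  the self-convolution of those of the Fejer kernel, and the lower bound for its mean
  \<open>a\<close> comes from the Cauchy-Schwarz inequality.\<close>

lemma trig_poly_fejer_square:
  assumes "J > 0"
  obtains a where "real J / 2 \<le> a" "trig_poly (2 * J) (2 * real J) a (\<lambda>x. (fejer J x)\<^sup>2)"
proof -
  obtain c :: "int \<Rightarrow> real" where c: "c 0 = 1" "\<And>j. 0 \<le> c j" "\<And>j. c j \<le> 1" "\<And>j. c (- j) = c j"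
    "\<And>x. of_real (fejer J x) = (\<Sum>j\<in>{- int J<..<int J}. of_real (c j) * unit_exp (of_int j * x))"
    using fejer_expansion[OF assms] by blast
  define I where "I = {- int J<..<int J}"
  have finI: "finite I" unfolding I_def by simp
  have cardI: "real (card I) \<le> 2 * real J" unfolding I_def by simp
  define P where "P j = {ik \<in> I \<times> I. fst ik + snd ik = j}" for j
  define b where "b j = (\<Sum>ik\<in>P j. c (fst ik) * c (snd ik))" for j
  define a where "a = (\<Sum>i\<in>I. (c i)\<^sup>2)"
  \<comment> \<open>At 0 all exponentials equal 1 and the kernel takes the value
    \<open>J\<close>.\<close>
  have "real J = (\<Sum>i\<in>I. c i)"
  proof -
    have "of_real (real J) = complex_of_real (\<Sum>i\<in>I. c i)"
      using c(5)[of 0] assms by (simp add: fejer_at_0 I_def)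
    then show ?thesis using of_real_eq_iff by blast
  qed
  then have "(real J)\<^sup>2 \<le> (\<Sum>i\<in>I. (1::real)\<^sup>2) * a"
    unfolding a_def using Cauchy_Schwarz_ineq_sum[of "\<lambda>_. 1" c I] by simp
  also have "\<dots> \<le> 2 * real J * a"
    using cardI unfolding a_def by (intro mult_right_mono sum_nonneg) auto
  finally have "real J * real J \<le> real J * (2 * a)" by (simp add: power2_eq_square mult_ac)
  then have a: "real J / 2 \<le> a" using assms by simp
  \<comment> \<open>Evenness of \<open>c\<close> turns the convolution at 0 into the sum of
    squares.\<close>
  have b0: "b 0 = a"
  proof -
    have "P 0 = (\<lambda>i. (i, - i)) ` I" unfolding P_def I_def by auto
    then show ?thesis unfolding b_def a_def
      by (simp add: sum.reindex inj_on_def c(4) power2_eq_square)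
  qed
  have bb: "cmod (of_real (b j)) \<le> 2 * real J" for j
  proof -
    have "b j \<le> (\<Sum>ik\<in>P j. 1)" unfolding b_def by (intro sum_mono mult_le_one c)
    also have "\<dots> = real (card (P j))" by simp
    also have "card (P j) \<le> card I"
      by (rule card_inj_on_le[where f = fst]) (auto simp: P_def inj_on_def finI)
    finally have "b j \<le> 2 * real J" using cardI by simp
    moreover have "0 \<le> b j" unfolding b_def by (intro sum_nonneg mult_nonneg_nonneg c)
    ultimately show ?thesis by simp
  qed
  have ex: "of_real ((fejer J x)\<^sup>2) = (\<Sum>j\<in>{- int (2 * J)<..<int (2 * J)}. of_real (b j) * unit_exp (of_int j * x))" for x
  proof -
    let ?g = "\<lambda>ik. of_real (c (fst ik) * c (snd ik)) * unit_exp (of_int (fst ik + snd ik) * x)"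
    have "of_real ((fejer J x)\<^sup>2) = (\<Sum>i\<in>I. of_real (c i) * unit_exp (of_int i * x)) * (\<Sum>i\<in>I. of_real (c i) * unit_exp (of_int i * x))"
      unfolding of_real_power c(5) I_def by (simp add: power2_eq_square)
    also have "\<dots> = (\<Sum>ik\<in>I \<times> I. ?g ik)"
      unfolding sum_product sum.cartesian_product
    proof (rule sum.cong[OF refl], clarify)
      fix i k :: int
      have "unit_exp (of_int (i + k) * x) = unit_exp (of_int i * x) * unit_exp (of_int k * x)"
        by (simp add: distrib_right unit_exp_add)
      then show "of_real (c i) * unit_exp (of_int i * x) * (of_real (c k) * unit_exp (of_int k * x)) = ?g (i, k)"
        by simp
    qed
    also have "\<dots> = (\<Sum>j\<in>{- int (2 * J)<..<int (2 * J)}. \<Sum>ik\<in>P j. ?g ik)"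
      unfolding P_def by (rule sum.group[symmetric]) (auto simp: finI, auto simp: I_def)
    also have "\<dots> = (\<Sum>j\<in>{- int (2 * J)<..<int (2 * J)}. of_real (b j) * unit_exp (of_int j * x))"
    proof (rule sum.cong[OF refl])
      fix j
      have "?g ik = of_real (c (fst ik) * c (snd ik)) * unit_exp (of_int j * x)" if "ik \<in> P j" for ik
        using that unfolding P_def by auto
      then have "(\<Sum>ik\<in>P j. ?g ik) = (\<Sum>ik\<in>P j. of_real (c (fst ik) * c (snd ik)) * unit_exp (of_int j * x))"
        by (rule sum.cong[OF refl])
      then show "(\<Sum>ik\<in>P j. ?g ik) = of_real (b j) * unit_exp (of_int j * x)"
        unfolding b_def of_real_sum sum_distrib_right .
    qed
    finally show ?thesis .
  qed
  have "trig_poly (2 * J) (2 * real J) a (\<lambda>x. (fejer J x)\<^sup>2)"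
    unfolding trig_poly_def using bb ex b0 by (intro exI[of _ "\<lambda>j. of_real (b j)"]) auto
  with a show ?thesis by (rule that)
qed

text \<open>The weights form a probability distribution on a grid of \<open>2 * J\<close> points
  with second moment of order \<open>1 / J\<^sup>2\<close>, measured by the squared sine. One of the
  two Fejer factors cancels the squared sine up to \<open>1 / J\<close>, and the other is summed
  exactly over the grid.\<close>

lemma jackson_weight:
  assumes "J > 0"
  obtains w :: "real \<Rightarrow> real" where "\<And>x. 0 \<le> w x"
    "trig_poly (2 * J) (2 / real J) (1 / real (2 * J)) w"
    "\<And>x. (\<Sum>r<2 * J. w (x - real r / real (2 * J))) = 1"
    "\<And>x. (\<Sum>r<2 * J. w (x - real r / real (2 * J)) * (sin (pi * (x - real r / real (2 * J))))\<^sup>2) \<le> 2 / (real J)\<^sup>2"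
proof -
  obtain a where a: "real J / 2 \<le> a" "trig_poly (2 * J) (2 * real J) a (\<lambda>x. (fejer J x)\<^sup>2)"
    using trig_poly_fejer_square[OF assms] .
  have a0: "a > 0" using a(1) assms by (simp add: less_le_trans[of 0 "real J / 2"])
  \<comment> \<open>Makes the mean \<open>1 / (2 * J)\<close>, so that the \<open>2 * J\<close>
    translates sum to 1.\<close>
  define t where "t = 1 / (real (2 * J) * a)"
  have t0: "t > 0" unfolding t_def using a0 assms by simp
  define w where "w x = t * (fejer J x)\<^sup>2" for x
  have "trig_poly (2 * J) (t * (2 * real J)) (t * a) w"
    unfolding w_def by (rule trig_poly_scale[OF a(2)]) (use t0 in simp)
  moreover have "t * a = 1 / real (2 * J)" unfolding t_def using a0 assms by simp
  moreover have "t * (2 * real J) \<le> 2 / real J"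
  proof -
    have "t * (2 * real J) = 1 / a" unfolding t_def using assms by simp
    also have "\<dots> \<le> 1 / (real J / 2)" using a(1) a0 assms by (intro divide_left_mono) auto
    finally show ?thesis by simp
  qed
  ultimately have tp: "trig_poly (2 * J) (2 / real J) (1 / real (2 * J)) w"
    using trig_poly_mono[of "2 * J" "t * (2 * real J)" "t * a" w "2 * J" "2 / real J"] assms by simp
  have "(\<Sum>r<2 * J. w (x - real r / real (2 * J)) * (sin (pi * (x - real r / real (2 * J))))\<^sup>2) \<le> 2 / (real J)\<^sup>2" for x
  proof -
    have le: "w y * (sin (pi * y))\<^sup>2 \<le> t / real J * fejer J y" for y
    proof -
      have "w y * (sin (pi * y))\<^sup>2 = t * fejer J y * (fejer J y * (sin (pi * y))\<^sup>2)"
        unfolding w_def by (simp add: power2_eq_square mult_ac)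
      also have "\<dots> = t * fejer J y * ((sin (pi * (real J * y)))\<^sup>2 / real J)" unfolding fejer_sin ..
      also have "\<dots> \<le> t * fejer J y * (1 / real J)"
        using t0 by (intro mult_left_mono divide_right_mono) (auto simp: abs_square_le_1)
      finally show ?thesis by simp
    qed
    \<comment> \<open>The degree bound is relaxed to match the number of grid points.\<close>
    have "trig_poly (2 * J) 1 1 (fejer J)"
      using trig_poly_mono[OF trig_poly_fejer[OF assms]] assms by simp
    then have s: "(\<Sum>r<2 * J. fejer J (x - real r / real (2 * J))) = real (2 * J) * 1"
      using assms by (intro trig_poly_sum_shifts) auto
    have "(\<Sum>r<2 * J. w (x - real r / real (2 * J)) * (sin (pi * (x - real r / real (2 * J))))\<^sup>2)
       \<le> (\<Sum>r<2 * J. t / real J * fejer J (x - real r / real (2 * J)))"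
      by (intro sum_mono le)
    also have "\<dots> = t / real J * real (2 * J)" unfolding sum_distrib_left[symmetric] s by simp
    also have "\<dots> = (1 / real J) * (1 / a)" unfolding t_def using assms by simp
    also have "\<dots> \<le> (1 / real J) * (1 / (real J / 2))" using a(1) a0 assms by (intro mult_left_mono divide_left_mono) auto
    also have "\<dots> = 2 / (real J)\<^sup>2" by (simp add: power2_eq_square)
    finally show ?thesis .
  qed
  moreover have "(\<Sum>r<2 * J. w (x - real r / real (2 * J))) = 1" for x
    using trig_poly_sum_shifts[OF tp, of x] assms by simp
  moreover have "0 \<le> w x" for x unfolding w_def using t0 by simp
  ultimately show ?thesis using that tp by blast
qed

section \<open>Smoothed indicators of intervals modulo 1\<close>

lemma card_near_integer:
  fixes M :: nat and \<rho> :: real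
  assumes "M > 0" and "\<rho> \<ge> 0"
  defines "S \<equiv> {r. r < M \<and> int_dist (real r / real M) \<le> \<rho>}"
  shows "real (card S) \<le> 2 * \<rho> * real M + 1"
    and "\<rho> < 1 / 2 \<Longrightarrow> 2 * \<rho> * real M - 1 \<le> real (card S)"
proof -
  \<comment> \<open>The grid points near an integer are the indices up to \<open>R\<close> (near 0)
    and the last \<open>R\<close> indices (near 1), at most \<open>2 * R + 1\<close> in all; for
    \<open>\<rho> < 1 / 2\<close> the two blocks do not overlap and the count is exact.\<close>
  define R where "R = nat \<lfloor>\<rho> * real M\<rfloor>"
  have R: "real R \<le> \<rho> * real M" "\<rho> * real M < real R + 1"
    unfolding R_def using assms by auto
  have finS: "finite S" unfolding S_def by simp
  have "S \<subseteq> {..R} \<union> {M - R..<M}"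
  proof
    fix r assume "r \<in> S"
    then have r: "r < M" "int_dist (real r / real M) \<le> \<rho>" unfolding S_def by auto
    define x where "x = real r / real M"
    have x: "0 \<le> x" "x < 1" "real r = x * real M" unfolding x_def using r(1) assms(1) by auto
    have d: "\<bar>x - of_int (round x)\<bar> \<le> \<rho>" using r(2) unfolding x_def int_dist_def .
    have "\<bar>x - of_int (round x)\<bar> \<le> 1 / 2" using int_dist_le_half[of x] unfolding int_dist_def .
    with x(1,2) have "of_int (round x) < (2::real)" "of_int (round x) > (-1::real)" by linarith+
    then have "round x = 0 \<or> round x = 1" by linarith
    then show "r \<in> {..R} \<union> {M - R..<M}"
    proof
      assume "round x = 0"
      with d x have "x \<le> \<rho>" by simp
      then have "real r \<le> \<rho> * real M" unfolding x(3) by (intro mult_right_mono) auto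
      with R(2) show ?thesis by auto
    next
      assume "round x = 1"
      with d x have "1 - x \<le> \<rho>" by simp
      then have "(1 - x) * real M \<le> \<rho> * real M" by (intro mult_right_mono) auto
      then have "real M - real r \<le> \<rho> * real M" unfolding x(3) by (simp add: left_diff_distrib)
      with R(2) r(1) show ?thesis by auto
    qed
  qed
  then have "card S \<le> card ({..R} \<union> {M - R..<M})" by (intro card_mono) auto
  also have "\<dots> \<le> card {..R} + card {M - R..<M}" by (rule card_Un_le)
  also have "\<dots> \<le> 2 * R + 1" by simp
  finally have "real (card S) \<le> 2 * real R + 1" by linarith
  then show "real (card S) \<le> 2 * \<rho> * real M + 1" using R(1) by simp
  assume "\<rho> < 1 / 2"
  then have "\<rho> * real M < 1 / 2 * real M" using assms(1) by (intro mult_strict_right_mono) auto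
  then have RM: "2 * R < M" using R(1) by linarith
  have "{..R} \<union> {M - R..<M} \<subseteq> S"
  proof
    fix r assume "r \<in> {..R} \<union> {M - R..<M}"
    then have "r < M" "real r \<le> \<rho> * real M \<or> real M - real r \<le> \<rho> * real M"
      using RM R(1) by auto
    moreover have "int_dist (real r / real M) * real M \<le> real r"
      using int_dist_le[of "real r / real M" 0] assms(1) by (simp add: field_simps)
    moreover have "int_dist (real r / real M) * real M \<le> real M - real r"
      using int_dist_le[of "real r / real M" 1] assms(1) \<open>r < M\<close> by (simp add: field_simps)
    ultimately have "int_dist (real r / real M) * real M \<le> \<rho> * real M" by linarith
    with \<open>r < M\<close> show "r \<in> S" unfolding S_def using assms(1) by simp
  qed
  then have "card ({..R} \<union> {M - R..<M}) \<le> card S" by (intro card_mono finS)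
  moreover have "card ({..R} \<union> {M - R..<M}) = card {..R} + card {M - R..<M}"
    using RM by (intro card_Un_disjoint) auto
  ultimately have "2 * R + 1 \<le> card S" using RM by simp
  then show "2 * \<rho> * real M - 1 \<le> real (card S)" using R(2) by linarith
qed

text \<open>The value \<open>f x\<close> is the probability that a random grid point, with Jackson
  weights centred at \<open>x\<close>, falls within \<open>\<rho>\<close> of an integer. Chebyshev's
  inequality makes it small when \<open>x\<close> is well outside that interval and close to 1 when
  \<open>x\<close> is well inside.\<close>

lemma smoothed_indicator:
  fixes J :: nat and \<rho> :: real
  assumes J: "J > 0" and \<rho>: "\<rho> \<ge> 0"
  obtains f :: "real \<Rightarrow> real" and c where "trig_poly (2 * J) (4 * c) c f"
    "0 \<le> c" "c \<le> 2 * \<rho> + 1 / (2 * real J)" "\<rho> < 1 / 2 \<Longrightarrow> 2 * \<rho> - 1 / (2 * real J) \<le> c"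
    "\<And>x. 0 \<le> f x" "\<And>x. f x \<le> 1"
    "\<And>x \<tau>. 0 < \<tau> \<Longrightarrow> \<rho> + \<tau> \<le> int_dist x \<Longrightarrow> f x \<le> 1 / (2 * (real J)\<^sup>2 * \<tau>\<^sup>2)"
    "\<And>x \<tau>. 0 < \<tau> \<Longrightarrow> int_dist x + \<tau> \<le> \<rho> \<Longrightarrow> 1 - f x \<le> 1 / (2 * (real J)\<^sup>2 * \<tau>\<^sup>2)"
proof -
  obtain w where w: "\<And>x. 0 \<le> w x"
    "trig_poly (2 * J) (2 / real J) (1 / real (2 * J)) w"
    "\<And>x. (\<Sum>r<2 * J. w (x - real r / real (2 * J))) = 1"
    "\<And>x. (\<Sum>r<2 * J. w (x - real r / real (2 * J)) * (sin (pi * (x - real r / real (2 * J))))\<^sup>2) \<le> 2 / (real J)\<^sup>2"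
    using jackson_weight[OF J] by blast
  define M where "M = 2 * J"
  have M: "M > 0" "real M = 2 * real J" unfolding M_def using J by auto
  note w = w[folded M_def]
  define S where "S = {r. r < M \<and> int_dist (real r / real M) \<le> \<rho>}"
  have S: "S \<subseteq> {..<M}" "finite S" unfolding S_def by auto
  define f where "f x = (\<Sum>r\<in>S. w (x - real r / real M))" for x
  define c where "c = real (card S) / real M"
  \<comment> \<open>Chebyshev's inequality: on \<open>Q\<close> the squared sine is at least
    \<open>(2 * \<tau>)\<^sup>2\<close>, while the whole second moment is at most
    \<open>2 / J\<^sup>2\<close>.\<close>
  have tail: "(\<Sum>r\<in>Q. w (x - real r / real M)) \<le> 1 / (2 * (real J)\<^sup>2 * \<tau>\<^sup>2)"
    if "Q \<subseteq> {..<M}" "0 < \<tau>" "\<And>r. r \<in> Q \<Longrightarrow> \<tau> \<le> int_dist (x - real r / real M)" for Q x \<tau>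
  proof -
    have "(\<Sum>r\<in>Q. w (x - real r / real M)) * (4 * \<tau>\<^sup>2) = (\<Sum>r\<in>Q. w (x - real r / real M) * (2 * \<tau>)\<^sup>2)"
      by (simp add: sum_distrib_right power2_eq_square)
    also have "\<dots> \<le> (\<Sum>r\<in>Q. w (x - real r / real M) * (sin (pi * (x - real r / real M)))\<^sup>2)"
    proof (intro sum_mono mult_left_mono w)
      fix r assume "r \<in> Q"
      then have "2 * \<tau> \<le> \<bar>sin (pi * (x - real r / real M))\<bar>"
        using that(3)[of r] abs_sin_pi_ge[of "x - real r / real M"] by linarith
      then have "(2 * \<tau>)\<^sup>2 \<le> \<bar>sin (pi * (x - real r / real M))\<bar>\<^sup>2" using that(2) by (intro power_mono) auto
      then show "(2 * \<tau>)\<^sup>2 \<le> (sin (pi * (x - real r / real M)))\<^sup>2" by simp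
    qed
    also have "\<dots> \<le> (\<Sum>r<M. w (x - real r / real M) * (sin (pi * (x - real r / real M)))\<^sup>2)"
      using that(1) w(1) by (intro sum_mono2) auto
    also have "\<dots> \<le> 2 / (real J)\<^sup>2" by (rule w)
    finally show ?thesis using that(2) J by (simp add: field_simps)
  qed
  have compl: "1 - f x = (\<Sum>r\<in>{..<M} - S. w (x - real r / real M))" for x
    using sum.subset_diff[OF S(1) finite_lessThan, of "\<lambda>r. w (x - real r / real M)"] w(3)[of x]
    unfolding f_def by simp
  show ?thesis
  proof (rule that[of c f])
    \<comment> \<open>Each translate has coefficients at most \<open>2 / J\<close>, four times its
      mean \<open>1 / (2 * J)\<close>; the ratio 4 persists in the sum.\<close>
    have "trig_poly M (real (card S) * (2 / real J)) (real (card S) * (1 / real M)) f"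
      unfolding f_def by (rule trig_poly_sum[OF S(2)]) (rule trig_poly_shift[OF w(2)])
    then show "trig_poly (2 * J) (4 * c) c f" unfolding c_def M(2) M_def[symmetric] using J by (simp add: mult.commute)
    show "0 \<le> c" unfolding c_def by simp
    have "real (card S) \<le> 2 * \<rho> * real M + 1" unfolding S_def by (rule card_near_integer(1)[OF M(1) \<rho>])
    then show "c \<le> 2 * \<rho> + 1 / (2 * real J)" unfolding c_def M(2)[symmetric] using M(1) by (simp add: field_simps)
    show "2 * \<rho> - 1 / (2 * real J) \<le> c" if "\<rho> < 1 / 2"
    proof -
      have "2 * \<rho> * real M - 1 \<le> real (card S)" unfolding S_def by (rule card_near_integer(2)[OF M(1) \<rho> that])
      then have "(2 * \<rho> * real M - 1) / real M \<le> c" unfolding c_def by (rule divide_right_mono) simp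
      then show ?thesis unfolding M(2)[symmetric] using M(1) by (simp add: diff_divide_distrib)
    qed
    show "0 \<le> f x" for x unfolding f_def by (intro sum_nonneg w)
    have "0 \<le> 1 - f x" for x unfolding compl by (intro sum_nonneg w)
    then show "f x \<le> 1" for x by simp
    show "f x \<le> 1 / (2 * (real J)\<^sup>2 * \<tau>\<^sup>2)" if "0 < \<tau>" "\<rho> + \<tau> \<le> int_dist x" for x \<tau>
      unfolding f_def
    proof (rule tail[OF S(1) that(1)])
      fix r assume "r \<in> S"
      then show "\<tau> \<le> int_dist (x - real r / real M)"
        using int_dist_triangle[of x "real r / real M"] that(2) unfolding S_def by auto
    qed
    show "1 - f x \<le> 1 / (2 * (real J)\<^sup>2 * \<tau>\<^sup>2)" if "0 < \<tau>" "int_dist x + \<tau> \<le> \<rho>" for x \<tau>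
      unfolding compl
    proof (rule tail[OF _ that(1)])
      fix r assume "r \<in> {..<M} - S"
      then show "\<tau> \<le> int_dist (x - real r / real M)"
        using int_dist_triangle[of "real r / real M" x] int_dist_minus[of "real r / real M" x] that(2)
        unfolding S_def by auto
    qed auto
  qed
qed

section \<open>A nonnegative kernel with a quadratically decaying lower bound\<close>

definition fejer_pair :: "nat \<Rightarrow> real \<Rightarrow> real" where
  "fejer_pair L x = (fejer L x + fejer L (x + 1 / (2 * real L))) / real L"

lemma fejer_pair_nonneg: "0 \<le> fejer_pair L x"
  unfolding fejer_pair_def by simp

text \<open>Division by \<open>L\<close> makes the kernel of order 1 within distance of order
  \<open>1 / L\<close> of the integers, at the cost of a mean of only \<open>2 / L\<close>.\<close>

lemma trig_poly_fejer_pair: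
  assumes L: "L > 0"
  shows "trig_poly L (2 / real L) (2 / real L) (fejer_pair L)"
proof -
  have "trig_poly L (real (card {0::nat, 1}) * 1) (real (card {0::nat, 1}) * 1)
          (\<lambda>x. \<Sum>r\<in>{0::nat, 1}. fejer L (x - (- (real r / (2 * real L)))))"
    by (rule trig_poly_sum) (auto intro!: trig_poly_shift[of L 1 1 "fejer L" "- _", simplified] trig_poly_fejer L)
  then have "trig_poly L 2 2 (\<lambda>x. fejer L x + fejer L (x + 1 / (2 * real L)))" by simp
  from trig_poly_scale[OF this, of "1 / real L"]
  show ?thesis unfolding fejer_pair_def by simp
qed

text \<open>The half-step shift turns the sine of one numerator into the cosine of the other, so that the two
  numerators sum to 1 and the zeros of the kernel are filled in.\<close>

lemma fejer_pair_lower: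
  assumes L: "L > 0"
  shows "1 \<le> fejer_pair L x * (pi * (real L * int_dist x + 1 / 2))\<^sup>2"
proof -
  define y where "y = x + 1 / (2 * real L)"
  \<comment> \<open>A common bound for the squared sines at \<open>x\<close> and \<open>y\<close>;
    the shift accounts for the extra \<open>1 / (2 * L)\<close>.\<close>
  define s where "s = (pi * (int_dist x + 1 / (2 * real L)))\<^sup>2"
  have "int_dist (y - x) \<le> 1 / (2 * real L)" using int_dist_le[of "y - x" 0] unfolding y_def by simp
  then have y: "int_dist y \<le> int_dist x + 1 / (2 * real L)" using int_dist_triangle[of y x] by linarith
  have le: "(sin (pi * z))\<^sup>2 \<le> s" if "int_dist z \<le> int_dist x + 1 / (2 * real L)" for z
  proof -
    have "\<bar>sin (pi * z)\<bar> \<le> pi * int_dist z" by (rule abs_sin_pi_le)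
    also have "\<dots> \<le> pi * (int_dist x + 1 / (2 * real L))" using that by (intro mult_left_mono) auto
    finally have "\<bar>sin (pi * z)\<bar>\<^sup>2 \<le> s" unfolding s_def by (intro power_mono) auto
    then show ?thesis by simp
  qed
  have "pi * (real L * y) = pi * (real L * x) + pi / 2" unfolding y_def using L by (simp add: field_simps)
  then have sc: "sin (pi * (real L * y)) = cos (pi * (real L * x))" by (simp add: sin_add)
  have "1 / real L = (sin (pi * (real L * x)))\<^sup>2 / real L + (sin (pi * (real L * y)))\<^sup>2 / real L"
    unfolding sc by (simp flip: add_divide_distrib)
  also have "\<dots> = fejer L x * (sin (pi * x))\<^sup>2 + fejer L y * (sin (pi * y))\<^sup>2"
    unfolding fejer_sin ..
  also have "\<dots> \<le> fejer L x * s + fejer L y * s"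
    by (intro add_mono mult_left_mono le y) auto
  also have "\<dots> = (fejer_pair L x * real L) * s" unfolding fejer_pair_def y_def using L by (simp flip: distrib_right)
  finally have "1 \<le> fejer_pair L x * ((real L)\<^sup>2 * s)" using L by (simp add: field_simps power2_eq_square)
  also have "real L * (pi * (int_dist x + 1 / (2 * real L))) = pi * (real L * int_dist x + 1 / 2)"
    using L by (simp add: field_simps)
  then have "(real L)\<^sup>2 * s = (pi * (real L * int_dist x + 1 / 2))\<^sup>2"
    unfolding s_def power_mult_distrib[symmetric] by simp
  finally show ?thesis .
qed

section \<open>Exponential sums over the box\<close>

lemma bij_betw_vec_nth_box:
  "bij_betw vec_nth {a :: 'a ^ 'n. \<forall>u. a $ u \<in> I} (UNIV \<rightarrow>\<^sub>E I)"
  by (rule bij_betw_byWitness[where f' = "\<lambda>g. \<chi> u. g u"]) (auto simp: vec_eq_iff)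

lemma finite_vec_box:
  assumes "finite I"
  shows "finite {a :: 'a ^ 'n. \<forall>u. a $ u \<in> I}"
proof -
  have "finite ((UNIV :: 'n set) \<rightarrow>\<^sub>E I)" using assms by (intro finite_PiE) auto
  then show ?thesis using bij_betw_finite[OF bij_betw_vec_nth_box] by blast
qed

text \<open>Serves both to expand a product of polynomials over frequency vectors and to factor an
  exponential sum over the box into one-dimensional sums.\<close>

lemma prod_sum_vec:
  fixes f :: "'n::finite \<Rightarrow> 'a \<Rightarrow> 'c::comm_semiring_1"
  assumes "finite I"
  shows "(\<Prod>u\<in>UNIV. \<Sum>y\<in>I. f u y) = (\<Sum>a | \<forall>u. a $ u \<in> I. \<Prod>u\<in>UNIV. f u (a $ u))"
proof -
  have "(\<Prod>u\<in>UNIV. \<Sum>y\<in>I. f u y) = (\<Sum>g\<in>UNIV \<rightarrow>\<^sub>E I. \<Prod>u\<in>UNIV. f u (g u))"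
    by (rule prod_sum_PiE) (use assms in auto)
  also have "\<dots> = (\<Sum>a | \<forall>u. a $ u \<in> I. \<Prod>u\<in>UNIV. f u (a $ u))"
    by (rule sum.reindex_bij_betw[OF bij_betw_vec_nth_box, symmetric])
  finally show ?thesis .
qed

lemma vec_cons_mult_nth:
  fixes A :: "real ^ 'm ^ 'd"
  shows "(vec_cons t v v* vec_cons \<alpha> A) $ k = t * \<alpha> $ k + (\<Sum>u\<in>UNIV. v $ u * A $ u $ k)"
proof -
  have "(vec_cons t v v* vec_cons \<alpha> A) $ k = (\<Sum>i\<in>UNIV. vec_cons t v $ i * vec_cons \<alpha> A $ i $ k)"
    by (simp add: vector_matrix_mult_def)
  also have "\<dots> = t * \<alpha> $ k + (\<Sum>i\<in>range Some. vec_cons t v $ i * vec_cons \<alpha> A $ i $ k)"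
    by (simp add: UNIV_option_conv vec_cons_def)
  also have "(\<Sum>i\<in>range Some. vec_cons t v $ i * vec_cons \<alpha> A $ i $ k) = (\<Sum>u\<in>UNIV. v $ u * A $ u $ k)"
    by (simp add: sum.reindex vec_cons_def)
  finally show ?thesis .
qed

lemma sum_unit_exp_eq_dirichlet:
  "(\<Sum>a\<in>{1..int q}. unit_exp (of_int a * t)) = unit_exp t * dirichlet q t"
proof -
  have "(\<Sum>a\<in>{1..int q}. unit_exp (of_int a * t)) = (\<Sum>r<q. unit_exp (real (Suc r) * t))"
    by (rule sum.reindex_bij_witness[where i = "\<lambda>r. int (Suc r)" and j = "\<lambda>a. nat (a - 1)"]) auto
  also have "\<dots> = unit_exp t * dirichlet q t"
    unfolding dirichlet_def sum_distrib_left by (simp add: distrib_right unit_exp_add)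
  finally show ?thesis .
qed

text \<open>Expand the product over \<open>k\<close> into frequency vectors \<open>j\<close> and
  interchange sums. For each \<open>j\<close> the sum over \<open>a\<close> is, up to a phase, a
  product of geometric sums, one for each row of \<open>A\<close>; frequency 0 gives the main term,
  and every other coefficient is at most \<open>B ^ CARD('m)\<close>. Here \<open>pos\<close>
  excludes the value \<open>1 / 0 = 0\<close>, at which the bound for a geometric sum could
  fail.\<close>

lemma trig_poly_box_sum:
  fixes A :: "real ^ 'm ^ 'd" and \<alpha> :: "real ^ 'm"
  assumes p: "trig_poly J B c0 p" and J: "J > 0"
    and pos: "\<And>j :: int ^ 'm. \<And>u. j \<noteq> 0 \<Longrightarrow> int_dist (of_int_vec j \<bullet> row u A) > 0"
  shows "\<bar>(\<Sum>a | \<forall>u. a $ u \<in> {1..int q}. \<Prod>k\<in>UNIV. p ((vec_cons (real q) (of_int_vec a) v* vec_cons \<alpha> A) $ k))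
            - c0 ^ CARD('m) * real q ^ CARD('d)\<bar>
     \<le> B ^ CARD('m) * (\<Sum>j\<in>{j :: int ^ 'm. \<forall>k. j $ k \<in> {- int J<..<int J}} - {0}.
            \<Prod>u\<in>UNIV. 1 / int_dist (of_int_vec j \<bullet> row u A))"
proof -
  obtain c where c: "c 0 = of_real c0" "\<And>j. cmod (c j) \<le> B"
    "\<And>x. of_real (p x) = (\<Sum>j\<in>{- int J<..<int J}. c j * unit_exp (of_int j * x))"
    using p unfolding trig_poly_def by blast
  define Box where "Box = {a :: int ^ 'd. \<forall>u. a $ u \<in> {1..int q}}"
  define V where "V = {j :: int ^ 'm. \<forall>k. j $ k \<in> {- int J<..<int J}}"
  have finV: "finite V" unfolding V_def by (rule finite_vec_box) simp
  have V0: "0 \<in> V" unfolding V_def using J by simp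
  define X where "X a k = (vec_cons (real q) (of_int_vec a) v* vec_cons \<alpha> A) $ k" for a :: "int ^ 'd" and k
  define C where "C j = (\<Prod>k\<in>UNIV. c (j $ k))" for j :: "int ^ 'm"
  define \<theta> where "\<theta> j u = of_int_vec j \<bullet> row u A" for j :: "int ^ 'm" and u
  define G where "G j = (\<Sum>a\<in>Box. unit_exp (\<Sum>k\<in>UNIV. of_int (j $ k) * X a k))" for j :: "int ^ 'm"
  \<comment> \<open>The row \<open>\<alpha>\<close> enters only through a term constant in
    \<open>a\<close>, hence through a factor of modulus 1; this makes the bound uniform in
    \<open>\<alpha>\<close>.\<close>
  have phase: "(\<Sum>k\<in>UNIV. of_int (j $ k) * X a k) = real q * (of_int_vec j \<bullet> \<alpha>) + (\<Sum>u\<in>UNIV. of_int (a $ u) * \<theta> j u)" for j a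
  proof -
    have "(\<Sum>k\<in>UNIV. of_int (j $ k) * X a k)
        = (\<Sum>k\<in>UNIV. real q * (of_int (j $ k) * \<alpha> $ k)) + (\<Sum>k\<in>UNIV. \<Sum>u\<in>UNIV. of_int (a $ u) * (of_int (j $ k) * A $ u $ k))"
      unfolding X_def vec_cons_mult_nth
      by (simp add: of_int_vec_def distrib_left sum.distrib sum_distrib_left mult_ac)
    also have "(\<Sum>k\<in>UNIV. \<Sum>u\<in>UNIV. of_int (a $ u) * (of_int (j $ k) * A $ u $ k)) = (\<Sum>u\<in>UNIV. of_int (a $ u) * \<theta> j u)"
      by (subst sum.swap) (simp add: \<theta>_def inner_vec_def of_int_vec_def row_def sum_distrib_left)
    also have "(\<Sum>k\<in>UNIV. real q * (of_int (j $ k) * \<alpha> $ k)) = real q * (of_int_vec j \<bullet> \<alpha>)"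
      by (simp add: inner_vec_def of_int_vec_def sum_distrib_left)
    finally show ?thesis .
  qed
  have G: "G j = unit_exp (real q * (of_int_vec j \<bullet> \<alpha>)) * (\<Prod>u\<in>UNIV. \<Sum>a\<in>{1..int q}. unit_exp (of_int a * \<theta> j u))" for j
    unfolding G_def phase Box_def
    by (subst prod_sum_vec) (simp_all add: unit_exp_add unit_exp_sum sum_distrib_left)
  have G0: "G 0 = of_real (real q ^ CARD('d))"
    unfolding G by (simp add: \<theta>_def of_int_vec_def inner_vec_def)
  have normG: "cmod (G j) \<le> (\<Prod>u\<in>UNIV. 1 / int_dist (\<theta> j u))" if "j \<noteq> 0" for j
  proof -
    have "cmod (G j) = (\<Prod>u\<in>UNIV. cmod (dirichlet q (\<theta> j u)))"
      unfolding G sum_unit_exp_eq_dirichlet by (simp add: norm_mult prod_norm[symmetric])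
    also have "\<dots> \<le> (\<Prod>u\<in>UNIV. 1 / int_dist (\<theta> j u))"
      using pos[OF that] unfolding \<theta>_def by (intro prod_mono conjI norm_dirichlet_le) auto
    finally show ?thesis .
  qed
  have "of_real (\<Sum>a\<in>Box. \<Prod>k\<in>UNIV. p (X a k)) = (\<Sum>a\<in>Box. \<Sum>j\<in>V. C j * unit_exp (\<Sum>k\<in>UNIV. of_int (j $ k) * X a k))"
    unfolding of_real_sum of_real_prod c(3) V_def
    by (subst prod_sum_vec) (simp_all add: prod.distrib unit_exp_sum C_def)
  also have "\<dots> = (\<Sum>j\<in>V. C j * G j)"
    unfolding G_def sum_distrib_left by (rule sum.swap)
  also have "\<dots> = C 0 * G 0 + (\<Sum>j\<in>V - {0}. C j * G j)" by (rule sum.remove[OF finV V0])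
  finally have eq: "of_real ((\<Sum>a\<in>Box. \<Prod>k\<in>UNIV. p (X a k)) - c0 ^ CARD('m) * real q ^ CARD('d)) = (\<Sum>j\<in>V - {0}. C j * G j)"
    by (simp add: G0 C_def c(1))
  have "\<bar>(\<Sum>a\<in>Box. \<Prod>k\<in>UNIV. p (X a k)) - c0 ^ CARD('m) * real q ^ CARD('d)\<bar> = cmod (\<Sum>j\<in>V - {0}. C j * G j)"
    unfolding eq[symmetric] by (simp only: norm_of_real)
  also have "\<dots> \<le> (\<Sum>j\<in>V - {0}. B ^ CARD('m) * (\<Prod>u\<in>UNIV. 1 / int_dist (\<theta> j u)))"
  proof (rule sum_norm_le)
    fix j assume j: "j \<in> V - {0}"
    have "cmod (C j) = (\<Prod>k\<in>UNIV. cmod (c (j $ k)))" unfolding C_def by (simp add: prod_norm)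
    also have "\<dots> \<le> (\<Prod>k\<in>(UNIV :: 'm set). B)" by (intro prod_mono) (use c(2) in auto)
    finally have "cmod (C j) \<le> B ^ CARD('m)" by simp
    then show "cmod (C j * G j) \<le> B ^ CARD('m) * (\<Prod>u\<in>UNIV. 1 / int_dist (\<theta> j u))"
      unfolding norm_mult using normG[of j] j by (intro mult_mono) (auto intro: order_trans[OF norm_ge_zero])
  qed
  finally show ?thesis unfolding sum_distrib_left Box_def V_def X_def \<theta>_def .
qed

section \<open>Bounding the contribution of all nonzero frequencies\<close>

lemma infnorm_of_int_vec_le:
  assumes "\<And>k. \<bar>j $ k\<bar> \<le> b"
  shows "infnorm (of_int_vec j) \<le> of_int b"
  unfolding infnorm_cart
proof (rule cSup_least)
  fix x assume "x \<in> {\<bar>of_int_vec j $ i\<bar> |i. i \<in> UNIV}"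
  then obtain i where "x = \<bar>real_of_int (j $ i)\<bar>" by (auto simp: of_int_vec_def)
  with assms[of i] show "x \<le> of_int b" by linarith
qed auto

text \<open>The bound for separated points is applied to the signed distances of
  \<open>j \<bullet> row u A\<close> to the nearest integers. The difference of two distinct
  frequencies is again a nonzero frequency of size below \<open>2 * J\<close>, so \<open>low\<close>
  supplies both the lower bound and the separation.\<close>

lemma sum_inverse_int_dist_le:
  fixes A :: "real ^ 'm ^ 'd" and \<omega> c K :: real
  assumes "\<omega> > 0" and "c > 0" and "K > 0"
    and low: "\<And>j :: int ^ 'm. j \<noteq> 0 \<Longrightarrow>
      c \<le> infnorm (of_int_vec j) powr \<omega> * (\<Prod>u\<in>UNIV. int_dist (of_int_vec j \<bullet> row u A))"
  obtains C where "C \<ge> 0" "\<And>\<delta> J. 0 < \<delta> \<Longrightarrow> \<delta> \<le> 1 / 2 \<Longrightarrow> J > 0 \<Longrightarrow> real J \<le> K / \<delta> \<Longrightarrow>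
      (\<Sum>j\<in>{j :: int ^ 'm. \<forall>k. j $ k \<in> {- int J<..<int J}} - {0}.
         \<Prod>u\<in>UNIV. 1 / int_dist (of_int_vec j \<bullet> row u A))
      \<le> C * (\<delta> powr (- \<omega>) * ln (1 / \<delta>) ^ CARD('d))"
proof
  \<comment> \<open>Chosen so that \<open>(2 * J) powr \<omega> / c\<close> is at most
    \<open>Q * \<delta> powr (- \<omega>)\<close>; the separation \<open>lam\<close> is the
    reciprocal of the latter.\<close>
  define Q where "Q = (2 * K) powr \<omega> / c"
  have Q: "Q > 0" unfolding Q_def using \<open>c > 0\<close> \<open>K > 0\<close> by simp
  \<comment> \<open>Chosen so that \<open>L + 1 \<le> D * ln (1 / \<delta>)\<close>; since
    \<open>\<delta> \<le> 1 / 2\<close>, constants are absorbed through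
    \<open>ln 2 \<le> ln (1 / \<delta>)\<close>.\<close>
  define D where "D = (max 0 (log 2 Q) + 1 + \<omega>) / ln 2"
  have D: "D \<ge> 0" unfolding D_def using \<open>\<omega> > 0\<close> by auto
  define C where "C = (2 ^ CARD('d) + 1) * Q * (2 * D) ^ CARD('d)"
  show "C \<ge> 0" unfolding C_def using Q D by simp
  fix \<delta> :: real and J :: nat
  assume \<delta>: "0 < \<delta>" "\<delta> \<le> 1 / 2" and J: "J > 0" "real J \<le> K / \<delta>"
  define V where "V = {j :: int ^ 'm. \<forall>k. j $ k \<in> {- int J<..<int J}}"
  define \<theta> where "\<theta> j u = of_int_vec j \<bullet> row u A" for j :: "int ^ 'm" and u
  define y where "y j u = \<theta> j u - of_int (round (\<theta> j u))" for j u
  have absy: "\<bar>y j u\<bar> = int_dist (\<theta> j u)" for j u unfolding y_def int_dist_def ..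
  define lam where "lam = 1 / (Q * \<delta> powr (- \<omega>))"
  have lam: "lam > 0" unfolding lam_def using Q \<delta> by simp
  \<comment> \<open>The range \<open>2 * J\<close> covers the frequencies themselves as well as
    their differences.\<close>
  have lamle: "lam \<le> (\<Prod>u\<in>UNIV. int_dist (\<theta> j u))" if "j \<noteq> 0" "\<And>k. \<bar>j $ k\<bar> \<le> 2 * int J" for j
  proof -
    have "infnorm (of_int_vec j) \<le> of_int (2 * int J)" by (rule infnorm_of_int_vec_le) (rule that)
    also have "\<dots> \<le> 2 * K / \<delta>" using J by simp
    finally have "infnorm (of_int_vec j) powr \<omega> \<le> (2 * K / \<delta>) powr \<omega>"
      using \<open>\<omega> > 0\<close> by (intro powr_mono2) (auto simp: infnorm_pos_le)
    also have "\<dots> = c * (Q * \<delta> powr (- \<omega>))"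
      unfolding Q_def using \<open>c > 0\<close> \<open>K > 0\<close> \<delta> by (simp add: powr_divide powr_minus_divide)
    finally have i: "infnorm (of_int_vec j) powr \<omega> \<le> c * (Q * \<delta> powr (- \<omega>))" .
    have "c \<le> infnorm (of_int_vec j) powr \<omega> * (\<Prod>u\<in>UNIV. int_dist (\<theta> j u))"
      unfolding \<theta>_def by (rule low[OF that(1)])
    also have "\<dots> \<le> c * (Q * \<delta> powr (- \<omega>)) * (\<Prod>u\<in>UNIV. int_dist (\<theta> j u))"
      by (intro mult_right_mono i prod_nonneg) auto
    finally have "c * 1 \<le> c * ((Q * \<delta> powr (- \<omega>)) * (\<Prod>u\<in>UNIV. int_dist (\<theta> j u)))" by (simp add: mult.assoc)
    then have "1 \<le> (Q * \<delta> powr (- \<omega>)) * (\<Prod>u\<in>UNIV. int_dist (\<theta> j u))" using \<open>c > 0\<close> by simp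
    then show ?thesis unfolding lam_def using Q \<delta> by (simp add: divide_le_eq mult_ac)
  qed
  define L where "L = max 0 (log 2 Q) + \<omega> * log 2 (1 / \<delta>)"
  have ln2: "ln 2 \<le> ln (1 / \<delta>)" using \<delta> by (intro ln_mono) (auto simp: field_simps)
  then have lpos: "0 < ln (1 / \<delta>)" using ln_gt_zero[of "2::real"] by linarith
  have L0: "L \<ge> 0" unfolding L_def log_def using \<open>\<omega> > 0\<close> lpos by simp
  have "log 2 (1 / lam) = log 2 Q + \<omega> * log 2 (1 / \<delta>)"
    unfolding lam_def using Q \<delta> by (simp add: log_mult log_powr log_divide)
  then have L1: "log 2 (1 / lam) \<le> L" unfolding L_def by simp
  have "L + 1 \<le> D * ln (1 / \<delta>)"
  proof -
    have "(max 0 (log 2 Q) + 1) * 1 \<le> (max 0 (log 2 Q) + 1) * (ln (1 / \<delta>) / ln 2)"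
      using ln2 by (intro mult_left_mono) auto
    moreover have "log 2 (1 / \<delta>) = ln (1 / \<delta>) / ln 2" by (simp add: log_def)
    moreover have "D * ln (1 / \<delta>) = (max 0 (log 2 Q) + 1) * (ln (1 / \<delta>) / ln 2) + \<omega> * (ln (1 / \<delta>) / ln 2)"
      unfolding D_def by (simp only: distrib_right add_divide_distrib times_divide_eq_left times_divide_eq_right)
    ultimately show ?thesis unfolding L_def by simp
  qed
  then have L2: "2 * (L + 1) \<le> 2 * D * ln (1 / \<delta>)" by simp
  have "(\<Sum>j\<in>V - {0}. \<Prod>u\<in>UNIV. 1 / \<bar>y j u\<bar>) \<le> (2 ^ CARD('d) + 1) / lam * (2 * (L + 1)) ^ CARD('d)"
  proof (rule sum_inverse_prod_le[OF _ lam _ _ _ L0 L1])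
    have "finite V" unfolding V_def by (rule finite_vec_box) simp
    then show "finite (V - {0})" by simp
    show "\<bar>y j u\<bar> \<le> 1 / 2" for j u unfolding absy by (rule int_dist_le_half)
    show "lam \<le> (\<Prod>u\<in>UNIV. \<bar>y j u\<bar>)" if "j \<in> V - {0}" for j
      unfolding absy
    proof (rule lamle)
      show "\<bar>j $ k\<bar> \<le> 2 * int J" for k
        using that unfolding V_def by (auto dest!: spec[of _ k])
    qed (use that in auto)
    show "lam \<le> (\<Prod>u\<in>UNIV. \<bar>y j u - y j' u\<bar>)" if "j \<in> V - {0}" "j' \<in> V - {0}" "j \<noteq> j'" for j j'
    proof -
      have "lam \<le> (\<Prod>u\<in>UNIV. int_dist (\<theta> (j - j') u))"
      proof (rule lamle)
        show "j - j' \<noteq> 0" using that by simp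
        show "\<bar>(j - j') $ k\<bar> \<le> 2 * int J" for k
          using that(1,2) unfolding V_def by (auto dest!: spec[of _ k])
      qed
      also have "\<dots> \<le> (\<Prod>u\<in>UNIV. \<bar>y j u - y j' u\<bar>)"
      \<comment> \<open>The number \<open>y j u - y j' u\<close> differs from
        \<open>\<theta> (j - j') u\<close> by an integer, so its absolute value is at least the
        distance of the latter to the integers.\<close>
      proof (intro prod_mono conjI int_dist_nonneg)
        fix u
        have "of_int_vec (j - j') = (of_int_vec j - of_int_vec j' :: real ^ 'm)"
          by (simp add: of_int_vec_def vec_eq_iff)
        then have "\<theta> (j - j') u = \<theta> j u - \<theta> j' u" unfolding \<theta>_def by (simp add: inner_diff_left)
        then show "int_dist (\<theta> (j - j') u) \<le> \<bar>y j u - y j' u\<bar>"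
          using int_dist_le[of "\<theta> (j - j') u" "round (\<theta> j u) - round (\<theta> j' u)"]
          unfolding y_def by (simp add: algebra_simps)
      qed
      finally show ?thesis .
    qed
  qed
  also have "\<dots> \<le> (2 ^ CARD('d) + 1) / lam * (2 * D * ln (1 / \<delta>)) ^ CARD('d)"
    using lam L0 L2 by (intro mult_left_mono power_mono) auto
  also have "\<dots> = C * (\<delta> powr (- \<omega>) * ln (1 / \<delta>) ^ CARD('d))"
    unfolding C_def lam_def by (simp add: power_mult_distrib)
  finally show "(\<Sum>j\<in>{j :: int ^ 'm. \<forall>k. j $ k \<in> {- int J<..<int J}} - {0}.
         \<Prod>u\<in>UNIV. 1 / int_dist (of_int_vec j \<bullet> row u A))
      \<le> C * (\<delta> powr (- \<omega>) * ln (1 / \<delta>) ^ CARD('d))"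
    unfolding absy \<theta>_def V_def .
qed

section \<open>Counting\<close>

lemma real_natceiling_bounds:
  fixes x :: real
  assumes "x \<ge> 0"
  shows "x \<le> real (nat \<lceil>x\<rceil>)" "real (nat \<lceil>x\<rceil>) \<le> x + 1"
  using assms by linarith+

text \<open>With \<open>1 / J \<le> \<eta>\<^sup>2 * \<delta>\<close>, a transition zone of width
  \<open>\<eta> * t\<close> gives a Chebyshev error of at most
  \<open>\<eta>\<^sup>2 / 2 * (\<delta> / t)\<^sup>2\<close>: small at \<open>t = \<delta>\<close>,
  and decaying quadratically beyond.\<close>

lemma smoothed_indicator_scaled:
  fixes \<eta> \<delta> \<rho> :: real
  assumes \<eta>: "0 < \<eta>" "\<eta> < 1" and \<delta>: "0 < \<delta>" "\<delta> \<le> 1 / 2" and \<rho>: "0 \<le> \<rho>" "\<rho> \<le> 2 * \<delta>"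
  obtains f :: "real \<Rightarrow> real" and c J where "trig_poly J (4 * c) c f" "J > 0" "real J \<le> 4 / \<eta>\<^sup>2 / \<delta>"
    "0 \<le> c" "c \<le> 5 * \<delta>" "c \<le> 2 * \<rho> + \<eta>\<^sup>2 / 2 * \<delta>" "\<rho> < 1 / 2 \<Longrightarrow> 2 * \<rho> - \<eta>\<^sup>2 / 2 * \<delta> \<le> c"
    "\<And>x. 0 \<le> f x" "\<And>x. f x \<le> 1"
    "\<And>x t. \<delta> \<le> t \<Longrightarrow> \<rho> + \<eta> * t \<le> int_dist x \<Longrightarrow> f x \<le> \<eta>\<^sup>2 / 2 * (\<delta> / t)\<^sup>2"
    "\<And>x. int_dist x + \<eta> * \<delta> \<le> \<rho> \<Longrightarrow> 1 - f x \<le> \<eta>\<^sup>2 / 2"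
proof -
  define J where "J = nat \<lceil>1 / (\<eta>\<^sup>2 * \<delta>)\<rceil>"
  have pos: "0 < \<eta>\<^sup>2 * \<delta>" using \<eta> \<delta> by simp
  have Jb: "1 / (\<eta>\<^sup>2 * \<delta>) \<le> real J" "real J \<le> 1 / (\<eta>\<^sup>2 * \<delta>) + 1"
    unfolding J_def using pos by (intro real_natceiling_bounds; simp)+
  have "0 < 1 / (\<eta>\<^sup>2 * \<delta>)" using pos by simp
  with Jb(1) have J0: "J > 0" by (intro gr0I) auto
  have sq: "\<eta>\<^sup>2 \<le> 1" using \<eta> by (simp add: abs_square_le_1)
  have "\<eta>\<^sup>2 * \<delta> \<le> 1 * 1" using sq \<delta> by (intro mult_mono) auto
  then have "1 \<le> 1 / (\<eta>\<^sup>2 * \<delta>)" using pos by simp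
  moreover have "4 / \<eta>\<^sup>2 / \<delta> = 4 * (1 / (\<eta>\<^sup>2 * \<delta>))" by simp
  \<comment> \<open>Rounding up costs at most 1, which is itself at most
    \<open>1 / (\<eta>\<^sup>2 * \<delta>)\<close>.\<close>
  ultimately have J2: "real (2 * J) \<le> 4 / \<eta>\<^sup>2 / \<delta>" using Jb(2) by linarith
  have "1 / real J \<le> 1 / (1 / (\<eta>\<^sup>2 * \<delta>))"
    using Jb(1) J0 pos by (intro divide_left_mono) auto
  then have inv: "1 / (2 * real J) \<le> \<eta>\<^sup>2 / 2 * \<delta>" by simp
  have tail: "1 / (2 * (real J)\<^sup>2 * (\<eta> * t)\<^sup>2) \<le> \<eta>\<^sup>2 / 2 * (\<delta> / t)\<^sup>2" if "t > 0" for t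
  proof -
    have "(1 / real J)\<^sup>2 \<le> (\<eta>\<^sup>2 * \<delta>)\<^sup>2"
      using inv by (intro power_mono) auto
    then have "(1 / real J)\<^sup>2 * (1 / (2 * (\<eta> * t)\<^sup>2)) \<le> (\<eta>\<^sup>2 * \<delta>)\<^sup>2 * (1 / (2 * (\<eta> * t)\<^sup>2))"
      by (intro mult_right_mono) auto
    also have "\<dots> = \<eta>\<^sup>2 / 2 * (\<delta> / t)\<^sup>2" using \<eta> by (simp add: power2_eq_square)
    finally show ?thesis by (simp add: power_divide mult_ac)
  qed
  show thesis
  proof (rule smoothed_indicator[OF J0 \<rho>(1)])
    fix c :: real and f :: "real \<Rightarrow> real"
    assume f: "trig_poly (2 * J) (4 * c) c f"
    "0 \<le> c" "c \<le> 2 * \<rho> + 1 / (2 * real J)" "\<rho> < 1 / 2 \<Longrightarrow> 2 * \<rho> - 1 / (2 * real J) \<le> c"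
    "\<And>x. 0 \<le> f x" "\<And>x. f x \<le> 1"
    "\<And>x \<tau>. 0 < \<tau> \<Longrightarrow> \<rho> + \<tau> \<le> int_dist x \<Longrightarrow> f x \<le> 1 / (2 * (real J)\<^sup>2 * \<tau>\<^sup>2)"
    "\<And>x \<tau>. 0 < \<tau> \<Longrightarrow> int_dist x + \<tau> \<le> \<rho> \<Longrightarrow> 1 - f x \<le> 1 / (2 * (real J)\<^sup>2 * \<tau>\<^sup>2)"
    show thesis
    proof (rule that[OF f(1) _ J2])
      show "0 < 2 * J" using J0 by simp
      show "0 \<le> c" by fact
      show c: "c \<le> 2 * \<rho> + \<eta>\<^sup>2 / 2 * \<delta>" using f(3) inv by linarith
      have "\<eta>\<^sup>2 / 2 * \<delta> \<le> 1 * \<delta>" using sq \<delta> by (intro mult_right_mono) auto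
      with c \<rho>(2) show "c \<le> 5 * \<delta>" by linarith
      show "2 * \<rho> - \<eta>\<^sup>2 / 2 * \<delta> \<le> c" if "\<rho> < 1 / 2" using f(4)[OF that] inv by linarith
      show "0 \<le> f x" "f x \<le> 1" for x by fact+
      show "f x \<le> \<eta>\<^sup>2 / 2 * (\<delta> / t)\<^sup>2" if "\<delta> \<le> t" "\<rho> + \<eta> * t \<le> int_dist x" for x t
        using f(7)[of "\<eta> * t" x] tail[of t] that \<eta> \<delta> by fastforce
      show "1 - f x \<le> \<eta>\<^sup>2 / 2" if "int_dist x + \<eta> * \<delta> \<le> \<rho>" for x
        using f(8)[of "\<eta> * \<delta>" x] tail[of \<delta>] that \<eta> \<delta> by simp
    qed
  qed
qed

text \<open>The shifted Fejer pair with \<open>L\<close> about \<open>1 / \<delta>\<close>. Its mean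
  is \<open>O(\<delta>)\<close>, yet it dominates, up to the factor 64, both the box indicator and
  the Chebyshev tail.\<close>

lemma quadratic_decay_majorant:
  fixes \<delta> :: real
  assumes \<delta>: "0 < \<delta>" "\<delta> \<le> 1 / 2"
  obtains h :: "real \<Rightarrow> real" and c L where "trig_poly L (2 * \<delta>) c h" "L > 0" "real L \<le> 2 / \<delta>"
    "0 \<le> c" "c \<le> 2 * \<delta>" "\<And>x. 0 \<le> h x"
    "\<And>x. int_dist x < \<delta> \<Longrightarrow> 1 \<le> 64 * h x"
    "\<And>x. \<delta> \<le> int_dist x \<Longrightarrow> (\<delta> / int_dist x)\<^sup>2 \<le> 64 * h x"
proof -
  define L where "L = nat \<lceil>1 / \<delta>\<rceil>"
  have Lb: "1 / \<delta> \<le> real L" "real L \<le> 1 / \<delta> + 1"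
    unfolding L_def using \<delta> by (intro real_natceiling_bounds; simp)+
  have "0 < 1 / \<delta>" using \<delta> by simp
  with Lb(1) have L0: "L > 0" by (intro gr0I) auto
  have L\<delta>: "real L * \<delta> \<le> 3 / 2"
  proof -
    have "real L * \<delta> \<le> (1 / \<delta> + 1) * \<delta>" using Lb(2) \<delta> by (intro mult_right_mono) auto
    also have "\<dots> = 1 + \<delta>" using \<delta> by (simp add: distrib_right)
    finally show ?thesis using \<delta> by simp
  qed
  have inv: "2 / real L \<le> 2 * \<delta>" using Lb(1) L0 \<delta> by (simp add: field_simps)
  define h where "h = fejer_pair L"
  note F = trig_poly_fejer_pair[OF L0, folded h_def] fejer_pair_nonneg[of L, folded h_def]
    fejer_pair_lower[OF L0, folded h_def]
  \<comment> \<open>Since pi is less than 4, the squared factor in the lower bound for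
    \<open>h\<close> is at most \<open>(8 * s)\<^sup>2\<close>. It is used with \<open>s = 1\<close>
    near the integers and \<open>s = int_dist x / \<delta>\<close> away from them, where
    \<open>3 / 2 + 1 / 2 = 2\<close> explains the hypothesis.\<close>
  have bound: "1 \<le> 64 * h x * s\<^sup>2" if "real L * int_dist x + 1 / 2 \<le> 2 * s" for x s
  proof -
    have "pi * (real L * int_dist x + 1 / 2) \<le> 4 * (2 * s)"
      using that pi_less_4 by (intro mult_mono) auto
    then have "(pi * (real L * int_dist x + 1 / 2))\<^sup>2 \<le> (4 * (2 * s))\<^sup>2" by (intro power_mono) auto
    then have "h x * (pi * (real L * int_dist x + 1 / 2))\<^sup>2 \<le> h x * (4 * (2 * s))\<^sup>2"
      using F(2) by (rule mult_left_mono)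
    with F(3)[of x] show ?thesis by (simp add: power_mult_distrib)
  qed
  show ?thesis
  proof (rule that[of L "2 / real L" h])
    show "trig_poly L (2 * \<delta>) (2 / real L) h" using trig_poly_mono[OF F(1) _ inv] L0 by simp
    show "real L \<le> 2 / \<delta>" using L\<delta> \<delta> by (simp add: field_simps)
    show "0 \<le> h x" for x by (rule F)
    show "1 \<le> 64 * h x" if "int_dist x < \<delta>" for x
    proof -
      have "real L * int_dist x \<le> real L * \<delta>" using that by (intro mult_left_mono) auto
      then show ?thesis using bound[of x 1] L\<delta> by simp
    qed
    show "(\<delta> / int_dist x)\<^sup>2 \<le> 64 * h x" if "\<delta> \<le> int_dist x" for x
    proof -
      define s where "s = int_dist x / \<delta>"
      have s: "1 \<le> s" "int_dist x = s * \<delta>" unfolding s_def using that \<delta> by auto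
      have "real L * \<delta> * s \<le> 3 / 2 * s" using L\<delta> s by (intro mult_right_mono) auto
      moreover have "real L * int_dist x = real L * \<delta> * s" unfolding s(2) by simp
      ultimately have "real L * int_dist x + 1 / 2 \<le> 2 * s" using s(1) by linarith
      from bound[OF this] have "1 / s\<^sup>2 \<le> 64 * h x" using s(1) by (simp add: divide_le_eq)
      moreover have "\<delta> / int_dist x = 1 / s" unfolding s_def by simp
      ultimately show ?thesis by (simp add: power_divide)
    qed
  qed (use L0 inv in auto)
qed

lemma count_A_eq_card:
  fixes B :: "real ^ 'm ^ ('d :: finite) option"
  assumes "q \<ge> 1"
  shows "count_A B q \<delta> = card {a \<in> {a :: int ^ 'd. \<forall>u. a $ u \<in> {1..int q}}.
           \<forall>k. int_dist ((vec_cons (real q) (of_int_vec a) v* B) $ k) < \<delta>}"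
proof -
  have "real_of_int x / real q \<in> {0<..1} \<longleftrightarrow> x \<in> {1..int q}" for x
    using assms by (auto simp: field_simps)
  moreover have "vec_int_dist y < \<delta> \<longleftrightarrow> (\<forall>k. int_dist (y $ k) < \<delta>)" for y :: "real ^ 'm"
    unfolding vec_int_dist_def by (subst Max_less_iff) auto
  ultimately show ?thesis unfolding count_A_def by simp
qed

text \<open>Uses the wide interval \<open>\<rho> = (1 + \<eta>) * \<delta>\<close>: at a counted
  point every factor is at least \<open>1 - \<eta>\<^sup>2 / 2\<close>, and at all other points the
  product is nonnegative.\<close>

lemma count_A_upper:
  fixes A :: "real ^ 'm ^ 'd" and \<alpha> :: "real ^ 'm" and \<eta> \<delta> E :: real
  assumes \<eta>: "0 < \<eta>" "\<eta> < 1" and \<delta>: "0 < \<delta>" "\<delta> \<le> 1 / 2" and q: "q \<ge> 1"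
    and pos: "\<And>j :: int ^ 'm. \<And>u. j \<noteq> 0 \<Longrightarrow> int_dist (of_int_vec j \<bullet> row u A) > 0"
    and E: "\<And>J. J > 0 \<Longrightarrow> real J \<le> 4 / \<eta>\<^sup>2 / \<delta> \<Longrightarrow>
      (\<Sum>j\<in>{j :: int ^ 'm. \<forall>k. j $ k \<in> {- int J<..<int J}} - {0}.
         \<Prod>u\<in>UNIV. 1 / int_dist (of_int_vec j \<bullet> row u A)) \<le> E"
  shows "(1 - \<eta>\<^sup>2 / 2) ^ CARD('m) * real (count_A (vec_cons \<alpha> A) q \<delta>)
     \<le> (2 * (1 + \<eta>) + \<eta>\<^sup>2 / 2) ^ CARD('m) * \<delta> ^ CARD('m) * real q ^ CARD('d)
       + (20 * \<delta>) ^ CARD('m) * E"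
proof -
  define Box where "Box = {a :: int ^ 'd. \<forall>u. a $ u \<in> {1..int q}}"
  define X where "X a k = (vec_cons (real q) (of_int_vec a) v* vec_cons \<alpha> A) $ k" for a :: "int ^ 'd" and k
  define P where "P = {a \<in> Box. \<forall>k. int_dist (X a k) < \<delta>}"
  have finB: "finite Box" unfolding Box_def by (rule finite_vec_box) simp
  have cnt: "count_A (vec_cons \<alpha> A) q \<delta> = card P"
    unfolding count_A_eq_card[OF q] P_def Box_def X_def ..
  have "\<eta> * \<delta> \<le> 1 * \<delta>" using \<eta> \<delta> by (intro mult_right_mono) auto
  then have \<rho>: "0 \<le> (1 + \<eta>) * \<delta>" "(1 + \<eta>) * \<delta> \<le> 2 * \<delta>" using \<eta> \<delta> by (auto simp: distrib_right)
  have half: "0 \<le> 1 - \<eta>\<^sup>2 / 2"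
    using abs_square_le_1[of \<eta>] \<eta> by simp
  show ?thesis
  proof (rule smoothed_indicator_scaled[OF \<eta> \<delta> \<rho>])
    fix f :: "real \<Rightarrow> real" and c J
    assume tp: "trig_poly J (4 * c) c f" and J: "J > 0" "real J \<le> 4 / \<eta>\<^sup>2 / \<delta>"
      and c: "0 \<le> c" "c \<le> 5 * \<delta>" "c \<le> 2 * ((1 + \<eta>) * \<delta>) + \<eta>\<^sup>2 / 2 * \<delta>"
      and f0: "\<And>x. 0 \<le> f x" and near: "\<And>x. int_dist x + \<eta> * \<delta> \<le> (1 + \<eta>) * \<delta> \<Longrightarrow> 1 - f x \<le> \<eta>\<^sup>2 / 2"
    define S where "S = (\<Sum>j\<in>{j :: int ^ 'm. \<forall>k. j $ k \<in> {- int J<..<int J}} - {0}.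
         \<Prod>u\<in>UNIV. 1 / int_dist (of_int_vec j \<bullet> row u A))"
    have S: "0 \<le> S" "S \<le> E" unfolding S_def using E[OF J] by (auto intro!: sum_nonneg prod_nonneg)
    have "(1 - \<eta>\<^sup>2 / 2) ^ CARD('m) * real (card P) = (\<Sum>a\<in>P. \<Prod>k\<in>(UNIV :: 'm set). 1 - \<eta>\<^sup>2 / 2)" by simp
    also have "\<dots> \<le> (\<Sum>a\<in>P. \<Prod>k\<in>UNIV. f (X a k))"
    proof (intro sum_mono prod_mono conjI half)
      fix a k assume "a \<in> P"
      then have "int_dist (X a k) < \<delta>" unfolding P_def by auto
      then have "1 - f (X a k) \<le> \<eta>\<^sup>2 / 2" by (intro near) (simp add: distrib_right)
      then show "1 - \<eta>\<^sup>2 / 2 \<le> f (X a k)" by simp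
    qed
    also have "\<dots> \<le> (\<Sum>a\<in>Box. \<Prod>k\<in>UNIV. f (X a k))"
      by (rule sum_mono2) (use finB f0 in \<open>auto simp: P_def intro: prod_nonneg\<close>)
    also have "\<dots> \<le> c ^ CARD('m) * real q ^ CARD('d) + (4 * c) ^ CARD('m) * S"
      using trig_poly_box_sum[OF tp J(1) pos, where \<alpha> = \<alpha> and q = q] unfolding Box_def X_def S_def by linarith
    also have "\<dots> \<le> ((2 * (1 + \<eta>) + \<eta>\<^sup>2 / 2) * \<delta>) ^ CARD('m) * real q ^ CARD('d) + (20 * \<delta>) ^ CARD('m) * E"
    proof (rule add_mono)
      have "c \<le> (2 * (1 + \<eta>) + \<eta>\<^sup>2 / 2) * \<delta>" using c(3) by (simp add: distrib_right)
      then show "c ^ CARD('m) * real q ^ CARD('d) \<le> ((2 * (1 + \<eta>) + \<eta>\<^sup>2 / 2) * \<delta>) ^ CARD('m) * real q ^ CARD('d)"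
        using c(1) by (intro mult_right_mono power_mono) auto
      \<comment> \<open>The constant 20 is the coefficient ratio 4 times the 5 in
        \<open>c \<le> 5 * \<delta>\<close>.\<close>
      have "(4 * c) ^ CARD('m) \<le> (20 * \<delta>) ^ CARD('m)" using c by (intro power_mono) auto
      then show "(4 * c) ^ CARD('m) * S \<le> (20 * \<delta>) ^ CARD('m) * E"
        using S \<delta> by (intro mult_mono) auto
    qed
    finally show ?thesis unfolding cnt by (simp add: power_mult_distrib)
  qed
qed

text \<open>Uses the narrow interval \<open>\<rho> = (1 - \<eta>) * \<delta>\<close>: the product of
  the \<open>f\<close> is at most 1 at counted points, and elsewhere some coordinate is far and
  gains \<open>\<eta>\<^sup>2 / 2\<close>. That leakage is dominated by the product of the
  \<open>h\<close>, whose sum over the box is again estimated by exponential sums.\<close>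

lemma count_A_lower:
  fixes A :: "real ^ 'm ^ 'd" and \<alpha> :: "real ^ 'm" and \<eta> \<delta> E :: real
  assumes \<eta>: "0 < \<eta>" "\<eta> < 1 / 2" and \<delta>: "0 < \<delta>" "\<delta> \<le> 1 / 2" and q: "q \<ge> 1"
    and pos: "\<And>j :: int ^ 'm. \<And>u. j \<noteq> 0 \<Longrightarrow> int_dist (of_int_vec j \<bullet> row u A) > 0"
    and E: "\<And>J. J > 0 \<Longrightarrow> real J \<le> 4 / \<eta>\<^sup>2 / \<delta> \<Longrightarrow>
      (\<Sum>j\<in>{j :: int ^ 'm. \<forall>k. j $ k \<in> {- int J<..<int J}} - {0}.
         \<Prod>u\<in>UNIV. 1 / int_dist (of_int_vec j \<bullet> row u A)) \<le> E"
  shows "((2 * (1 - \<eta>) - \<eta>\<^sup>2 / 2) ^ CARD('m) - \<eta>\<^sup>2 / 2 * 128 ^ CARD('m)) * \<delta> ^ CARD('m) * real q ^ CARD('d)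
       - ((20 * \<delta>) ^ CARD('m) + (128 * \<delta>) ^ CARD('m)) * E
     \<le> real (count_A (vec_cons \<alpha> A) q \<delta>)"
proof -
  define Box where "Box = {a :: int ^ 'd. \<forall>u. a $ u \<in> {1..int q}}"
  define X where "X a k = (vec_cons (real q) (of_int_vec a) v* vec_cons \<alpha> A) $ k" for a :: "int ^ 'd" and k
  define P where "P = {a \<in> Box. \<forall>k. int_dist (X a k) < \<delta>}"
  define S where "S J = (\<Sum>j\<in>{j :: int ^ 'm. \<forall>k. j $ k \<in> {- int J<..<int J}} - {0}.
       \<Prod>u\<in>UNIV. 1 / int_dist (of_int_vec j \<bullet> row u A))" for J :: nat
  have S0: "0 \<le> S J" for J unfolding S_def by (auto intro!: sum_nonneg prod_nonneg)
  have finB: "finite Box" unfolding Box_def by (rule finite_vec_box) simp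
  have cnt: "count_A (vec_cons \<alpha> A) q \<delta> = card P"
    unfolding count_A_eq_card[OF q] P_def Box_def X_def ..
  have "\<eta>\<^sup>2 \<le> (1 / 2)\<^sup>2" using \<eta> by (intro power_mono) auto
  then have sq: "\<eta>\<^sup>2 \<le> 1 / 4" by (simp add: power2_eq_square)
  have \<eta>1: "\<eta> < 1" using \<eta> by simp
  have "(1 - \<eta>) * \<delta> < 1 * \<delta>" using \<eta> \<delta> by (intro mult_strict_right_mono) auto
  moreover have "0 \<le> (1 - \<eta>) * \<delta>" using \<eta> \<delta> by simp
  ultimately have \<rho>: "0 \<le> (1 - \<eta>) * \<delta>" "(1 - \<eta>) * \<delta> \<le> 2 * \<delta>" "(1 - \<eta>) * \<delta> < 1 / 2"
    using \<delta> by linarith+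
  show ?thesis
  proof (rule smoothed_indicator_scaled[OF \<eta>(1) \<eta>1 \<delta> \<rho>(1,2)], rule quadratic_decay_majorant[OF \<delta>])
    fix f h :: "real \<Rightarrow> real" and c b J L
    assume tp: "trig_poly J (4 * c) c f" and J: "J > 0" "real J \<le> 4 / \<eta>\<^sup>2 / \<delta>"
      and c: "0 \<le> c" "c \<le> 5 * \<delta>" "(1 - \<eta>) * \<delta> < 1 / 2 \<Longrightarrow> 2 * ((1 - \<eta>) * \<delta>) - \<eta>\<^sup>2 / 2 * \<delta> \<le> c"
      and f0: "\<And>x. 0 \<le> f x" and f1: "\<And>x. f x \<le> 1"
      and far': "\<And>x t. \<delta> \<le> t \<Longrightarrow> (1 - \<eta>) * \<delta> + \<eta> * t \<le> int_dist x \<Longrightarrow> f x \<le> \<eta>\<^sup>2 / 2 * (\<delta> / t)\<^sup>2"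
      and tph: "trig_poly L (2 * \<delta>) b h" and L: "L > 0" "real L \<le> 2 / \<delta>"
      and b: "0 \<le> b" "b \<le> 2 * \<delta>" and h0: "\<And>x. 0 \<le> h x"
      and h1: "\<And>x. int_dist x < \<delta> \<Longrightarrow> 1 \<le> 64 * h x"
      and h2: "\<And>x. \<delta> \<le> int_dist x \<Longrightarrow> (\<delta> / int_dist x)\<^sup>2 \<le> 64 * h x"
    have "2 \<le> 4 / \<eta>\<^sup>2" using sq \<eta> by (simp add: field_simps)
    then have "2 / \<delta> \<le> 4 / \<eta>\<^sup>2 / \<delta>" using \<delta> by (intro divide_right_mono) auto
    then have SE: "S J \<le> E" "S L \<le> E" unfolding S_def using E[OF J] E[OF L(1)] L(2) by auto
    \<comment> \<open>The tail bound with \<open>t = int_dist x\<close>, matching the quadratic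
      decay that \<open>h\<close> dominates.\<close>
    have far: "f x \<le> \<eta>\<^sup>2 / 2 * (64 * h x)" if "\<delta> \<le> int_dist x" for x
    proof -
      have "(1 - \<eta>) * \<delta> \<le> (1 - \<eta>) * int_dist x" using that \<eta>1 by (intro mult_left_mono) auto
      then have "(1 - \<eta>) * \<delta> + \<eta> * int_dist x \<le> int_dist x" by (simp add: left_diff_distrib)
      then have "f x \<le> \<eta>\<^sup>2 / 2 * (\<delta> / int_dist x)\<^sup>2" by (rule far'[OF that])
      also have "\<dots> \<le> \<eta>\<^sup>2 / 2 * (64 * h x)" by (intro mult_left_mono h2 that) auto
      finally show ?thesis .
    qed
    have all: "f x \<le> 64 * h x" for x
    proof (cases "int_dist x < \<delta>")
      case True
      then show ?thesis using h1[of x] f1[of x] by linarith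
    next
      case False
      then have "f x \<le> \<eta>\<^sup>2 / 2 * (64 * h x)" by (intro far) auto
      also have "\<dots> \<le> 1 * (64 * h x)" using sq h0[of x] by (intro mult_right_mono) auto
      finally show ?thesis by simp
    qed
    have pt: "(\<Prod>k\<in>(UNIV :: 'm set). f (X a k)) \<le> (if a \<in> P then 1 else 0) + \<eta>\<^sup>2 / 2 * 64 ^ CARD('m) * (\<Prod>k\<in>UNIV. h (X a k))"
      if "a \<in> Box" for a
    proof (cases "a \<in> P")
      case True
      have "(\<Prod>k\<in>(UNIV :: 'm set). f (X a k)) \<le> 1" by (intro prod_le_1) (auto simp: f0 f1)
      moreover have "0 \<le> \<eta>\<^sup>2 / 2 * 64 ^ CARD('m) * (\<Prod>k\<in>UNIV. h (X a k))"
        by (intro mult_nonneg_nonneg prod_nonneg) (auto simp: h0)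
      ultimately show ?thesis using True by simp
    next
      case False
      \<comment> \<open>The far coordinate supplies the gain \<open>\<eta>\<^sup>2 / 2\<close> once;
        the remaining factors use only the domination by \<open>64 * h\<close>.\<close>
      then obtain k0 where k0: "\<delta> \<le> int_dist (X a k0)" using \<open>a \<in> Box\<close> unfolding P_def by (auto simp: not_less)
      have "(\<Prod>k\<in>(UNIV :: 'm set). f (X a k)) = f (X a k0) * (\<Prod>k\<in>UNIV - {k0}. f (X a k))"
        by (rule prod.remove) auto
      also have "\<dots> \<le> (\<eta>\<^sup>2 / 2 * (64 * h (X a k0))) * (\<Prod>k\<in>UNIV - {k0}. 64 * h (X a k))"
        by (intro mult_mono prod_mono far k0 conjI f0 all prod_nonneg mult_nonneg_nonneg h0) auto
      also have "\<dots> = \<eta>\<^sup>2 / 2 * ((64 * h (X a k0)) * (\<Prod>k\<in>UNIV - {k0}. 64 * h (X a k)))" by simp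
      also have "(64 * h (X a k0)) * (\<Prod>k\<in>UNIV - {k0}. 64 * h (X a k)) = (\<Prod>k\<in>UNIV. 64 * h (X a k))"
        by (rule prod.remove[symmetric]) auto
      also have "\<dots> = 64 ^ CARD('m) * (\<Prod>k\<in>UNIV. h (X a k))" by (simp add: prod.distrib)
      finally show ?thesis using False by simp
    qed
    let ?N = "real q ^ CARD('d)"
    have H: "(\<Sum>a\<in>Box. \<Prod>k\<in>UNIV. h (X a k)) \<le> (2 * \<delta>) ^ CARD('m) * (?N + E)"
    proof -
      have "(\<Sum>a\<in>Box. \<Prod>k\<in>UNIV. h (X a k)) \<le> b ^ CARD('m) * ?N + (2 * \<delta>) ^ CARD('m) * S L"
        using trig_poly_box_sum[OF tph L(1) pos, where \<alpha> = \<alpha> and q = q] unfolding Box_def X_def S_def by linarith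
      also have "\<dots> \<le> (2 * \<delta>) ^ CARD('m) * ?N + (2 * \<delta>) ^ CARD('m) * E"
        using b SE \<delta> by (intro add_mono mult_left_mono mult_right_mono power_mono) auto
      finally show ?thesis by (simp add: distrib_left)
    qed
    have "((2 * (1 - \<eta>) - \<eta>\<^sup>2 / 2) * \<delta>) ^ CARD('m) * ?N - (20 * \<delta>) ^ CARD('m) * E
        \<le> c ^ CARD('m) * ?N - (4 * c) ^ CARD('m) * S J"
    proof (rule diff_mono)
      show "((2 * (1 - \<eta>) - \<eta>\<^sup>2 / 2) * \<delta>) ^ CARD('m) * ?N \<le> c ^ CARD('m) * ?N"
      proof (intro mult_right_mono power_mono)
        show "(2 * (1 - \<eta>) - \<eta>\<^sup>2 / 2) * \<delta> \<le> c" using c(3)[OF \<rho>(3)] by (simp add: left_diff_distrib)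
        show "0 \<le> (2 * (1 - \<eta>) - \<eta>\<^sup>2 / 2) * \<delta>" using sq \<eta> \<delta> by (intro mult_nonneg_nonneg) auto
      qed auto
      show "(4 * c) ^ CARD('m) * S J \<le> (20 * \<delta>) ^ CARD('m) * E"
      proof (rule mult_mono)
        show "(4 * c) ^ CARD('m) \<le> (20 * \<delta>) ^ CARD('m)" using c by (intro power_mono) auto
      qed (use SE S0 \<delta> in auto)
    qed
    also have "\<dots> \<le> (\<Sum>a\<in>Box. \<Prod>k\<in>UNIV. f (X a k))"
      using trig_poly_box_sum[OF tp J(1) pos, where \<alpha> = \<alpha> and q = q] unfolding Box_def X_def S_def by linarith
    also have "\<dots> \<le> (\<Sum>a\<in>Box. (if a \<in> P then 1 else 0) + \<eta>\<^sup>2 / 2 * 64 ^ CARD('m) * (\<Prod>k\<in>UNIV. h (X a k)))"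
      by (intro sum_mono pt)
    also have "\<dots> = real (card P) + \<eta>\<^sup>2 / 2 * 64 ^ CARD('m) * (\<Sum>a\<in>Box. \<Prod>k\<in>UNIV. h (X a k))"
    proof -
      have "(\<Sum>a\<in>Box. if a \<in> P then 1 else 0) = real (card P)"
        using finB by (simp add: sum.If_cases P_def Int_def)
      then show ?thesis by (simp add: sum.distrib sum_distrib_left)
    qed
    also have "\<dots> \<le> real (card P) + \<eta>\<^sup>2 / 2 * 64 ^ CARD('m) * ((2 * \<delta>) ^ CARD('m) * (?N + E))"
      by (intro add_left_mono mult_left_mono H) auto
    also have "\<eta>\<^sup>2 / 2 * 64 ^ CARD('m) * ((2 * \<delta>) ^ CARD('m) * (?N + E))
        = \<eta>\<^sup>2 / 2 * (128 * \<delta>) ^ CARD('m) * ?N + \<eta>\<^sup>2 / 2 * ((128 * \<delta>) ^ CARD('m) * E)"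
    proof -
      have "(128 * \<delta>) ^ CARD('m) = 64 ^ CARD('m) * (2 * \<delta>) ^ CARD('m)"
        unfolding power_mult_distrib[symmetric] by simp
      then show ?thesis by (simp only: mult.assoc distrib_left)
    qed
    \<comment> \<open>In the frequency error the small factor is bounded by 1; in the multiple of
      \<open>?N\<close> it is kept, to be made small against \<epsilon>.\<close>
    also have "\<eta>\<^sup>2 / 2 * ((128 * \<delta>) ^ CARD('m) * E) \<le> 1 * ((128 * \<delta>) ^ CARD('m) * E)"
      using sq \<delta> S0[of J] SE by (intro mult_right_mono mult_nonneg_nonneg) auto
    finally have total: "((2 * (1 - \<eta>) - \<eta>\<^sup>2 / 2) * \<delta>) ^ CARD('m) * ?N - (20 * \<delta>) ^ CARD('m) * E
        \<le> real (card P) + (\<eta>\<^sup>2 / 2 * (128 * \<delta>) ^ CARD('m) * ?N + 1 * ((128 * \<delta>) ^ CARD('m) * E))"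
      by simp
    define G where "G = (2 * (1 - \<eta>) - \<eta>\<^sup>2 / 2) ^ CARD('m)"
    show ?thesis
      using total unfolding cnt power_mult_distrib G_def[symmetric] by (simp add: algebra_simps)
  qed
qed

text \<open>As \<eta> tends to 0 from the right, both inequalities tend to strict ones, comparing
  \<open>2 ^ m\<close> with \<open>2 ^ m + \<epsilon>\<close> and
  \<open>2 ^ m - \<epsilon>\<close>.\<close>

lemma smoothing_parameter_exists:
  fixes \<epsilon> :: real
  assumes "\<epsilon> > 0"
  obtains \<eta> :: real where "0 < \<eta>" "\<eta> < 1 / 2"
    "(2 * (1 + \<eta>) + \<eta>\<^sup>2 / 2) ^ m \<le> (2 ^ m + \<epsilon>) * (1 - \<eta>\<^sup>2 / 2) ^ m"
    "2 ^ m - \<epsilon> \<le> (2 * (1 - \<eta>) - \<eta>\<^sup>2 / 2) ^ m - \<eta>\<^sup>2 / 2 * 128 ^ m"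
proof -
  have "((\<lambda>\<eta>. (2 ^ m + \<epsilon>) * (1 - \<eta>\<^sup>2 / 2) ^ m - (2 * (1 + \<eta>) + \<eta>\<^sup>2 / 2) ^ m) \<longlongrightarrow>
      (2 ^ m + \<epsilon>) * (1 - 0\<^sup>2 / 2) ^ m - (2 * (1 + 0) + 0\<^sup>2 / 2) ^ m) (at_right (0::real))"
    by (intro tendsto_intros) auto
  then have 1: "eventually (\<lambda>\<eta>. 0 < (2 ^ m + \<epsilon>) * (1 - \<eta>\<^sup>2 / 2) ^ m - (2 * (1 + \<eta>) + \<eta>\<^sup>2 / 2) ^ m) (at_right (0::real))"
    by (rule order_tendstoD) (use assms in simp)
  have "((\<lambda>\<eta>. (2 * (1 - \<eta>) - \<eta>\<^sup>2 / 2) ^ m - \<eta>\<^sup>2 / 2 * 128 ^ m) \<longlongrightarrow>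
      (2 * (1 - 0) - 0\<^sup>2 / 2) ^ m - 0\<^sup>2 / 2 * 128 ^ m) (at_right (0::real))"
    by (intro tendsto_intros) auto
  then have 2: "eventually (\<lambda>\<eta>. 2 ^ m - \<epsilon> < (2 * (1 - \<eta>) - \<eta>\<^sup>2 / 2) ^ m - \<eta>\<^sup>2 / 2 * 128 ^ m) (at_right (0::real))"
    by (rule order_tendstoD) (use assms in simp)
  have 3: "eventually (\<lambda>\<eta>. \<eta> \<in> {0<..<1 / 2}) (at_right (0::real))"
    by (rule eventually_at_right_real) simp
  have "eventually (\<lambda>\<eta>. 0 < \<eta> \<and> \<eta> < 1 / 2 \<and>
    (2 * (1 + \<eta>) + \<eta>\<^sup>2 / 2) ^ m \<le> (2 ^ m + \<epsilon>) * (1 - \<eta>\<^sup>2 / 2) ^ m \<and>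
    2 ^ m - \<epsilon> \<le> (2 * (1 - \<eta>) - \<eta>\<^sup>2 / 2) ^ m - \<eta>\<^sup>2 / 2 * 128 ^ m) (at_right (0::real))"
    using 1 2 3 by eventually_elim auto
  then show ?thesis using that eventually_happens[of _ "at_right (0::real)"] by auto
qed

theorem theorem3p1:
  fixes \<omega> :: real and A :: "real ^ 'm ^ 'd"
  assumes "\<omega> > 0"
    and "(INF j \<in> UNIV - {0 :: int ^ 'm}.
            infnorm (of_int_vec j) powr \<omega> *
            (\<Prod>u\<in>UNIV. int_dist (of_int_vec j \<bullet> row u A))) > 0"
  shows "\<forall>\<epsilon>>0. \<exists>C :: real. \<forall>(\<alpha>\<^sub>0 :: real ^ 'm) (q :: nat) (\<delta> :: real).
           q \<ge> 1 \<and> 0 < \<delta> \<and> \<delta> \<le> 1 / 2 \<longrightarrow>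
           \<bar>real (count_A (vec_cons \<alpha>\<^sub>0 A) q \<delta>) - (2 * \<delta>) ^ CARD('m) * real q ^ CARD('d)\<bar>
             \<le> \<epsilon> * \<delta> ^ CARD('m) * real q ^ CARD('d)
               + C * \<delta> powr (real CARD('m) - \<omega>) * ln (1 / \<delta>) ^ CARD('d)"
proof (intro allI impI)
  fix \<epsilon> :: real assume "\<epsilon> > 0"
  define F where "F j = infnorm (of_int_vec j) powr \<omega> * (\<Prod>u\<in>UNIV. int_dist (of_int_vec j \<bullet> row u A))"
    for j :: "int ^ 'm"
  define c where "c = (INF j \<in> UNIV - {0}. F j)"
  have c: "c > 0" unfolding c_def F_def by (rule assms(2))
  have F0: "0 \<le> F j" for j unfolding F_def by (intro mult_nonneg_nonneg prod_nonneg) auto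
  \<comment> \<open>The real infimum is a lower bound because the values are bounded below by
    0.\<close>
  have low: "c \<le> F j" if "j \<noteq> 0" for j
    unfolding c_def by (rule cINF_lower) (use that F0 in \<open>auto intro!: bdd_belowI2[of _ 0]\<close>)
  have pos: "int_dist (of_int_vec j \<bullet> row u A) > 0" if "j \<noteq> 0" for j :: "int ^ 'm" and u
  proof -
    have "F j \<noteq> 0" using low[OF that] c by linarith
    then have "int_dist (of_int_vec j \<bullet> row u A) \<noteq> 0" unfolding F_def by auto
    then show ?thesis using int_dist_nonneg[of "of_int_vec j \<bullet> row u A"] by linarith
  qed
  let ?m = "CARD('m)" and ?d = "CARD('d)"
  obtain \<eta> :: real where \<eta>: "0 < \<eta>" "\<eta> < 1 / 2"
    "(2 * (1 + \<eta>) + \<eta>\<^sup>2 / 2) ^ ?m \<le> (2 ^ ?m + \<epsilon>) * (1 - \<eta>\<^sup>2 / 2) ^ ?m"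
    "2 ^ ?m - \<epsilon> \<le> (2 * (1 - \<eta>) - \<eta>\<^sup>2 / 2) ^ ?m - \<eta>\<^sup>2 / 2 * 128 ^ ?m"
    using smoothing_parameter_exists[OF \<open>\<epsilon> > 0\<close>] by blast
  have "4 / \<eta>\<^sup>2 > 0" using \<eta> by simp
  from sum_inverse_int_dist_le[OF assms(1) c this low[unfolded F_def]]
  obtain C0 where C0: "C0 \<ge> 0" "\<And>\<delta> J. 0 < \<delta> \<Longrightarrow> \<delta> \<le> 1 / 2 \<Longrightarrow> J > 0 \<Longrightarrow> real J \<le> 4 / \<eta>\<^sup>2 / \<delta> \<Longrightarrow>
      (\<Sum>j\<in>{j :: int ^ 'm. \<forall>k. j $ k \<in> {- int J<..<int J}} - {0}.
         \<Prod>u\<in>UNIV. 1 / int_dist (of_int_vec j \<bullet> row u A))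
      \<le> C0 * (\<delta> powr (- \<omega>) * ln (1 / \<delta>) ^ ?d)" by blast
  \<comment> \<open>Fixed before \<open>\<alpha>\<^sub>0\<close>, \<open>q\<close> and \<delta>. The
    term \<open>128 ^ ?m\<close> pays for the majorant in the lower bound; \<open>40 ^ ?m\<close>
    covers the coefficients of the smoothed indicators in both bounds.\<close>
  define C where "C = (40 ^ ?m + 128 ^ ?m) * C0"
  show "\<exists>C :: real. \<forall>(\<alpha>\<^sub>0 :: real ^ 'm) (q :: nat) (\<delta> :: real). q \<ge> 1 \<and> 0 < \<delta> \<and> \<delta> \<le> 1 / 2 \<longrightarrow>
           \<bar>real (count_A (vec_cons \<alpha>\<^sub>0 A) q \<delta>) - (2 * \<delta>) ^ ?m * real q ^ ?d\<bar>
             \<le> \<epsilon> * \<delta> ^ ?m * real q ^ ?d + C * \<delta> powr (real ?m - \<omega>) * ln (1 / \<delta>) ^ ?d"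
  proof (intro exI[of _ C] allI impI, elim conjE)
    fix \<alpha>\<^sub>0 :: "real ^ 'm" and q :: nat and \<delta> :: real
    assume q: "q \<ge> 1" and \<delta>: "0 < \<delta>" "\<delta> \<le> 1 / 2"
    define E where "E = C0 * (\<delta> powr (- \<omega>) * ln (1 / \<delta>) ^ ?d)"
    define N where "N = \<delta> ^ ?m * real q ^ ?d"
    define cnt where "cnt = real (count_A (vec_cons \<alpha>\<^sub>0 A) q \<delta>)"
    have "0 \<le> ln (1 / \<delta>)" using \<delta> by simp
    then have E0: "0 \<le> E" unfolding E_def using C0(1) by simp
    have N0: "0 \<le> N" unfolding N_def using \<delta> by simp
    have err: "C * \<delta> powr (real ?m - \<omega>) * ln (1 / \<delta>) ^ ?d = (40 ^ ?m + 128 ^ ?m) * (\<delta> ^ ?m * E)"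
      unfolding C_def E_def using \<delta> by (simp add: powr_diff powr_minus_divide powr_realpow)
    have \<delta>E: "0 \<le> \<delta> ^ ?m * E" using \<delta> E0 by simp
    have up: "cnt \<le> (2 ^ ?m + \<epsilon>) * N + 40 ^ ?m * (\<delta> ^ ?m * E)"
    proof -
      define t where "t = (1 - \<eta>\<^sup>2 / 2) ^ ?m"
      have "\<eta>\<^sup>2 \<le> 1" using \<eta> by (simp add: abs_square_le_1)
      \<comment> \<open>Dividing the upper estimate by \<open>t\<close> costs at most
        \<open>2 ^ ?m\<close> in the error, which turns 20 into 40; in the main term \<eta> was
        chosen to absorb it.\<close>
      then have th: "(1 / 2) ^ ?m \<le> t" unfolding t_def by (intro power_mono) auto
      then have t: "t > 0" by (rule less_le_trans[rotated]) simp
      have "t * cnt \<le> (2 * (1 + \<eta>) + \<eta>\<^sup>2 / 2) ^ ?m * \<delta> ^ ?m * real q ^ ?d + (20 * \<delta>) ^ ?m * E"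
        unfolding cnt_def t_def by (rule count_A_upper) (use \<eta> \<delta> q pos C0(2) in \<open>auto simp: E_def\<close>)
      also have "\<dots> = (2 * (1 + \<eta>) + \<eta>\<^sup>2 / 2) ^ ?m * N + 20 ^ ?m * (\<delta> ^ ?m * E)"
        unfolding N_def by (simp add: power_mult_distrib)
      also have "\<dots> \<le> ((2 ^ ?m + \<epsilon>) * t) * N + (40 ^ ?m * t) * (\<delta> ^ ?m * E)"
      proof (intro add_mono mult_right_mono N0 \<delta>E)
        have "(20::real) ^ ?m = 40 ^ ?m * (1 / 2) ^ ?m" by (simp flip: power_mult_distrib)
        also have "\<dots> \<le> 40 ^ ?m * t" using th by (intro mult_left_mono) auto
        finally show "20 ^ ?m \<le> 40 ^ ?m * t" .
      qed (use \<eta>(3) in \<open>simp add: t_def\<close>)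
      finally have "t * cnt \<le> t * ((2 ^ ?m + \<epsilon>) * N + 40 ^ ?m * (\<delta> ^ ?m * E))"
        by (simp add: algebra_simps)
      then show ?thesis using t by simp
    qed
    have lo: "(2 ^ ?m - \<epsilon>) * N - (40 ^ ?m + 128 ^ ?m) * (\<delta> ^ ?m * E) \<le> cnt"
    proof -
      have "(2 ^ ?m - \<epsilon>) * N \<le> ((2 * (1 - \<eta>) - \<eta>\<^sup>2 / 2) ^ ?m - \<eta>\<^sup>2 / 2 * 128 ^ ?m) * N"
        by (intro mult_right_mono \<eta> N0)
      moreover have "(20::real) ^ ?m * (\<delta> ^ ?m * E) \<le> 40 ^ ?m * (\<delta> ^ ?m * E)"
        by (intro mult_right_mono power_mono \<delta>E) auto
      moreover have "((2 * (1 - \<eta>) - \<eta>\<^sup>2 / 2) ^ ?m - \<eta>\<^sup>2 / 2 * 128 ^ ?m) * \<delta> ^ ?m * real q ^ ?d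
          - ((20 * \<delta>) ^ ?m + (128 * \<delta>) ^ ?m) * E \<le> cnt"
        unfolding cnt_def by (rule count_A_lower) (use \<eta> \<delta> q pos C0(2) in \<open>auto simp: E_def\<close>)
      ultimately show ?thesis unfolding N_def by (simp add: power_mult_distrib distrib_right mult.assoc)
    qed
    have "\<bar>cnt - 2 ^ ?m * N\<bar> \<le> \<epsilon> * N + (40 ^ ?m + 128 ^ ?m) * (\<delta> ^ ?m * E)"
    proof (rule abs_leI)
      have "0 \<le> 128 ^ ?m * (\<delta> ^ ?m * E)" using \<delta>E by simp
      with up show "cnt - 2 ^ ?m * N \<le> \<epsilon> * N + (40 ^ ?m + 128 ^ ?m) * (\<delta> ^ ?m * E)"
        unfolding distrib_right by linarith
      from lo show "- (cnt - 2 ^ ?m * N) \<le> \<epsilon> * N + (40 ^ ?m + 128 ^ ?m) * (\<delta> ^ ?m * E)"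
        unfolding left_diff_distrib by linarith
    qed
    then show "\<bar>real (count_A (vec_cons \<alpha>\<^sub>0 A) q \<delta>) - (2 * \<delta>) ^ ?m * real q ^ ?d\<bar>
             \<le> \<epsilon> * \<delta> ^ ?m * real q ^ ?d + C * \<delta> powr (real ?m - \<omega>) * ln (1 / \<delta>) ^ ?d"
      unfolding err unfolding cnt_def N_def power_mult_distrib mult.assoc .
  qed
qed

end
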